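(* There is an absolute constant $C>0$ such that the following holds. Let $A$ be the adjacency matrix of a random directed graph on $n$ vertices from the inhomogeneous Erdős–Rényi model with edge probabilities $(p_{ij})$, and let $d=\max_{i,j}np_{ij}$. For any $r\ge1$, the following holds with probability at least $1-3n^{-r}$. One can decompose the set of edges $[n]\times[n]$ into three classes $\mathcal{N}$, $\mathcal{R}$ and $\mathcal{C}$ so that the following properties are satisfied: (i) the graph concentrates on $\mathcal{N}$, namely $\|(A-\mathbb{E}A)_{\mathcal{N}}\|\le Cr^{3/2}\sqrt{d}$; (ii) each row of $A_{\mathcal{R}}$ and each column of $A_{\mathcal{C}}$ has at most $32r$ ones. Moreover, $\mathcal{R}$ intersects at most $n/d$ columns of $[n]\times[n]$, and $\mathcal{C}$ intersects at most $n/d$ rows of $[n]\times[n]$.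
   Context: $[n]=\{1,\dots,n\}$. Directed inhomogeneous Erdős–Rényi model: $A$ is an $n\times n$ random matrix whose entries $A_{ij}$, $(i,j)\in[n]\times[n]$, are all independent, take values in $\{0,1\}$, and satisfy $\mathbb{P}\{A_{ij}=1\}=p_{ij}$, where $p_{ij}\in[0,1]$ are given. For a matrix $B$ and a subset $\mathcal{S}\subset[n]\times[n]$, $B_{\mathcal{S}}$ denotes the $n\times n$ matrix which coincides with $B$ on the index pairs in $\mathcal{S}$ and has zero entries elsewhere. "Decompose" means partition into disjoint classes; the classes may depend on $A$. A set $\mathcal{S}\subset[n]\times[n]$ intersects the row $i$ (column $j$) if it contains some pair with first coordinate $i$ (second coordinate $j$). $\|\cdot\|$ denotes the spectral norm. *)

theory Defs
  imports "HOL-Probability.Probability"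
begin

text \<open>
  Since the constant of the theorem must not depend on the number of vertices, the dimension
  cannot be a type: an \<open>n \<times> n\<close> real matrix is a function on index pairs, of which only the values
  on \<open>grid n\<close>, i.e. \<open>[n] \<times> [n]\<close> with \<open>[n] = {1..n}\<close>, matter.
\<close>

type_synonym matrix = "nat \<times> nat \<Rightarrow> real"

definition grid :: "nat \<Rightarrow> (nat \<times> nat) set" where
  "grid n = {1..n} \<times> {1..n}"

definition restr :: "matrix \<Rightarrow> (nat \<times> nat) set \<Rightarrow> matrix" where
  "restr B S = (\<lambda>e. if e \<in> S then B e else 0)"

text \<open>The operator norm on Euclidean space: \<open>L2_set x {1..n}\<close> is the Euclidean norm of
  \<open>(x 1, \<dots>, x n)\<close>.\<close>

definition spectral_norm :: "nat \<Rightarrow> matrix \<Rightarrow> real" where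
  "spectral_norm n B =
     (SUP x\<in>{x. L2_set x {1..n} \<le> 1}. L2_set (\<lambda>i. \<Sum>j=1..n. B (i, j) * x j) {1..n})"

text \<open>The law of the random adjacency matrix: independent entries, \<open>p e\<close> being the probability
  that entry \<open>e\<close> is 1 (entries outside \<open>grid n\<close> are set to 0). Working with the law instead of a
  random variable on a sample space of polymorphic type keeps the constant of the theorem from
  depending on that type; \<open>random_matrix_er\<close> below shows that no generality is lost.\<close>

definition er :: "nat \<Rightarrow> matrix \<Rightarrow> matrix pmf" where
  "er n p = Pi_pmf (grid n) 0 (\<lambda>e. map_pmf of_bool (bernoulli_pmf (p e)))"

definition mean :: "matrix pmf \<Rightarrow> matrix" where
  "mean \<mu> = (\<lambda>e. measure_pmf.expectation \<mu> (\<lambda>A. A e))"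

lemma random_matrix_er:
  fixes M :: "'w measure" and A :: "'w \<Rightarrow> matrix"
  assumes "prob_space M" and "n \<ge> 1"
    and indep: "prob_space.indep_vars M (\<lambda>_. borel) (\<lambda>e \<omega>. A \<omega> e) (grid n)"
    and val: "\<And>e \<omega>. e \<in> grid n \<Longrightarrow> \<omega> \<in> space M \<Longrightarrow> A \<omega> e \<in> {0, 1}"
    and p: "\<And>e. e \<in> grid n \<Longrightarrow> p e \<in> {0..1} \<and> measure M {\<omega> \<in> space M. A \<omega> e = 1} = p e"
  shows "measure M {\<omega> \<in> space M. Q (restr (A \<omega>) (grid n))} = measure_pmf.prob (er n p) {B. Q B}"
proof -
  interpret prob_space M by fact
  have fin: "finite (grid n)" and ne: "grid n \<noteq> {}"
    using \<open>n \<ge> 1\<close> by (auto simp: grid_def)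
  define F where "F = PiE_dflt (grid n) (0::real) (\<lambda>_. {0, 1::real})"
  have finF: "finite F"
    unfolding F_def using fin by (intro finite_PiE_dflt) auto
  have meas: "(\<lambda>\<omega>. A \<omega> e) \<in> borel_measurable M" if "e \<in> grid n" for e
    using indep that by (auto simp: indep_vars_def)
  have evs: "{\<omega> \<in> space M. A \<omega> e = c} \<in> events" if "e \<in> grid n" for e c
    using meas[OF that] by measurable
  have entry: "prob {\<omega> \<in> space M. A \<omega> e = c} = pmf (map_pmf of_bool (bernoulli_pmf (p e))) c"
    if e: "e \<in> grid n" and c: "c \<in> {0, 1}" for e and c :: real
  proof -
    have pe: "0 \<le> p e" "p e \<le> 1" using p[OF e] by auto
    have inj: "inj (of_bool :: bool \<Rightarrow> real)" by (auto simp: inj_def of_bool_def split: if_splits)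
    have 1: "pmf (map_pmf of_bool (bernoulli_pmf (p e))) (1::real) = p e"
      using pmf_map_inj'[OF inj, of "bernoulli_pmf (p e)" True] pe by simp
    have 0: "pmf (map_pmf of_bool (bernoulli_pmf (p e))) (0::real) = 1 - p e"
      using pmf_map_inj'[OF inj, of "bernoulli_pmf (p e)" False] pe by simp
    have "{\<omega> \<in> space M. A \<omega> e = 0} = space M - {\<omega> \<in> space M. A \<omega> e = 1}"
      using val[OF e] by force
    then have "prob {\<omega> \<in> space M. A \<omega> e = 0} = 1 - p e"
      using prob_compl[OF evs[OF e]] p[OF e] by simp
    with 0 1 p[OF e] c show ?thesis by auto
  qed
  define E where "E B = {\<omega> \<in> space M. restr (A \<omega>) (grid n) = B}" for B
  have E_Int: "E B = (\<Inter>e\<in>grid n. (\<lambda>\<omega>. A \<omega> e) -` {B e} \<inter> space M)" if "B \<in> F" for B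
    using that ne by (auto simp: E_def F_def PiE_dflt_def restr_def fun_eq_iff)
  have E_ev: "E B \<in> events" if "B \<in> F" for B
    unfolding E_Int[OF that] using fin ne meas by (intro sets.finite_INT) auto
  have E_prob: "prob (E B) = pmf (er n p) B" if B: "B \<in> F" for B
  proof -
    have "prob (E B) = (\<Prod>e\<in>grid n. prob ((\<lambda>\<omega>. A \<omega> e) -` {B e} \<inter> space M))"
      unfolding E_Int[OF B] by (rule indep_varsD_finite[OF indep ne fin]) auto
    also have "\<dots> = (\<Prod>e\<in>grid n. pmf (map_pmf of_bool (bernoulli_pmf (p e))) (B e))"
    proof (rule prod.cong[OF refl])
      fix e assume e: "e \<in> grid n"
      have "(\<lambda>\<omega>. A \<omega> e) -` {B e} \<inter> space M = {\<omega> \<in> space M. A \<omega> e = B e}" by auto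
      moreover have "B e \<in> {0, 1}" using B e by (cases e) (force simp: F_def PiE_dflt_def)
      ultimately show "prob ((\<lambda>\<omega>. A \<omega> e) -` {B e} \<inter> space M) =
        pmf (map_pmf of_bool (bernoulli_pmf (p e))) (B e)" using entry[OF e] by simp
    qed
    also have "\<dots> = pmf (er n p) B"
      unfolding er_def using B fin by (subst pmf_Pi') (auto simp: F_def PiE_dflt_def)
    finally show ?thesis .
  qed
  have "{\<omega> \<in> space M. Q (restr (A \<omega>) (grid n))} = (\<Union>B\<in>{B\<in>F. Q B}. E B)"
    using val by (auto simp: E_def F_def PiE_dflt_def restr_def)
  then have "prob {\<omega> \<in> space M. Q (restr (A \<omega>) (grid n))} = (\<Sum>B\<in>{B\<in>F. Q B}. prob (E B))"
    using finF E_ev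
    by (simp only:, intro finite_measure_finite_Union) (auto simp: disjoint_family_on_def E_def)
  also have "\<dots> = (\<Sum>B\<in>{B\<in>F. Q B}. pmf (er n p) B)"
    by (intro sum.cong) (auto simp: E_prob)
  also have "\<dots> = measure_pmf.prob (er n p) {B\<in>F. Q B}"
    using finF by (simp add: measure_measure_pmf_finite)
  also have "\<dots> = measure_pmf.prob (er n p) {B. Q B}"
  proof -
    have "set_pmf (er n p) \<subseteq> F"
      unfolding er_def F_def set_Pi_pmf[OF fin] PiE_dflt_def
      by (clarsimp simp del: split_paired_All) (force simp: of_bool_def simp del: split_paired_All)
    then show ?thesis by (intro measure_prob_cong_0) (auto simp: set_pmf_eq)
  qed
  finally show ?thesis .
qed

end

theory Submission
  imports Defs
begin

text \<open>
  Discard the rows and columns of degree above \<open>8 r d\<close>; there are fewer than \<open>n / (2 d\<^sup>2)\<close> of each. On the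
  remaining block the norm is bounded by the Kahn--Szemeredi method: it suffices to test the bilinear
  form on vectors of a dyadic net. The pairs with \<open>\<bar>x i * y j\<bar> \<le> \<surd>d / n\<close> are handled by an exponential
  moment and a union bound, the heavy pairs by the bounded degrees and the discrepancy property,
  according to which no rectangle contains many more ones than expected.

  In the discarded rows and columns the zeros of \<open>A\<close> stay in \<open>N\<close>, where they contribute little because
  there are few such rows and columns, and the ones are split between \<open>R\<close> and \<open>K\<close> by peeling: by the
  discrepancy property every nonempty set of ones in few rows has a row or a column with at most
  \<open>32 r\<close> of them; move that row to \<open>R\<close>, or that column to \<open>K\<close>, and repeat. If \<open>d \<le> 1\<close>, all ones can be
  peeled off in this way.
\<close>

subsection \<open>Tails of edge counts\<close>

text \<open>The scale \<open>n / d^2\<close> serves the peeling. If the shorter side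
  \<open>m\<close> of a rectangle satisfies \<open>m * d^2 \<le> n\<close>, its mean number of ones
  per unit of the longer side \<open>M\<close> is \<open>q = m * d / n\<close> with
  \<open>q^2 \<le> M / n\<close>; an excess of ones then has a logarithm of at least half the
  entropy factor, which the discrepancy property forbids. The factor 2 is room for growth: lines
  outside the discarded ones may still hold more than \<open>32 * r\<close> discarded ones. They
  join the block to be peeled, and the discrepancy property bounds their number by that of the
  discarded lines of the other direction.

  The discarded rows and columns depend on \<open>A\<close>, so no union bound is taken over the
  remaining block. Instead the coordinates of the test vectors on discarded lines are set to 0; the
  net is closed under this operation, so one estimate uniform over the net covers every block.

  Powers of two as net values make the level classes of the test vectors rectangles, to which the
  discrepancy property applies directly, and turn all sums over levels into geometric ones, so that
  no logarithmic factor appears. Every norm estimate is linear in \<open>r\<close>, and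
  \<open>r \<le> r powr (3/2)\<close>.\<close>

lemma exp_le_one_plus_square:
  fixes z :: real
  assumes "\<bar>z\<bar> \<le> 1"
  shows "exp z \<le> 1 + z + z\<^sup>2"
proof (cases "z \<ge> 0")
  case True
  then show ?thesis using assms exp_bound by auto
next
  case False
  define w where "w = - z"
  have w: "0 < w" "w \<le> 1" using False assms by (auto simp: w_def)
  \<comment> \<open>The product is \<open>1 + w^3\<close>.\<close>
  have "1 \<le> (1 - w + w\<^sup>2) * (1 + w)"
    using w by (simp add: algebra_simps power2_eq_square)
  also have "\<dots> \<le> (1 - w + w\<^sup>2) * exp w"
    using w exp_ge_add_one_self[of w] by (intro mult_left_mono) auto
  finally have "exp (- w) \<le> 1 - w + w\<^sup>2"
    by (simp add: exp_minus field_simps)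
  then show ?thesis by (simp add: w_def)
qed

text \<open>\<open>exp (entropy n k)\<close> is \<open>(e * n / k)^k\<close>, the usual upper bound
  for the number of \<open>k\<close>-subsets of an \<open>n\<close>-set.\<close>

definition entropy :: "real \<Rightarrow> real \<Rightarrow> real" where
  "entropy n k = k * (1 + ln (n / k))"

text \<open>The derivative in \<open>k\<close> is \<open>ln (n / k)\<close>, which is nonnegative up
  to \<open>n\<close>; the proof replaces calculus by \<open>ln t \<le> t - 1\<close> at
  \<open>t = M / k\<close>.\<close>

lemma entropy_mono:
  assumes "0 < k" "k \<le> M" "M \<le> n"
  shows "entropy n k \<le> entropy n M"
proof -
  have 1: "ln (n / M) \<ge> 0" using assms by simp
  have 2: "ln (n / k) = ln (n / M) + ln (M / k)"
    using assms by (simp add: ln_div)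
  have 3: "ln (M / k) \<le> M / k - 1" using assms by (intro ln_le_minus_one) auto
  have "k * ln (M / k) \<le> k * (M / k - 1)"
    using 3 assms by (intro mult_left_mono) auto
  then have "k * ln (M / k) \<le> M - k" using assms by (simp add: algebra_simps)
  moreover have "k * ln (n / M) \<le> M * ln (n / M)"
    using assms 1 by (intro mult_right_mono) auto
  moreover have "(M - k) * ln (n / M) \<ge> 0" using 1 assms by simp
  ultimately show ?thesis by (simp add: entropy_def 2 algebra_simps)
qed

text \<open>Converts a saving \<open>exp (- r * entropy n k)\<close> in a union bound into
  \<open>n powr (- r)\<close>; the summand 1 supplies the factor
  \<open>exp (- 1) \<le> 1 / 2\<close>.\<close>

lemma entropy_ge:
  assumes "1 \<le> k" "k \<le> n"
  shows "1 + ln n \<le> entropy n k"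
  using entropy_mono[of 1 k n] assms by (simp add: entropy_def)

lemma binomial_le_exp_entropy:
  assumes "1 \<le> k" "k \<le> n"
  shows "real (n choose k) \<le> exp (entropy n k)"
proof -
  \<comment> \<open>The left-hand side is the \<open>k\<close>-th term of the exponential series at
    \<open>k\<close>.\<close>
  have "real k ^ k / fact k \<le> exp (real k)"
  proof -
    have "(\<Sum>j\<in>{k}. real k ^ j /\<^sub>R fact j) \<le> exp (real k)"
      unfolding exp_def by (intro sum_le_suminf summable_exp_generic) auto
    then show ?thesis by (simp add: field_simps)
  qed
  then have "real k ^ k \<le> exp (real k) * fact k" by (simp add: field_simps)
  moreover have "real (n choose k) * fact k \<le> real n ^ k"
    using binomial_fact_pow[of n k] by (metis of_nat_fact of_nat_le_iff of_nat_mult of_nat_power)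
  ultimately have "real (n choose k) * fact k * real k ^ k \<le> real n ^ k * (exp (real k) * fact k)"
    by (intro mult_mono) auto
  then have "real (n choose k) \<le> (n / k) ^ k * exp (real k)"
    using assms by (simp add: field_simps)
  also have "\<dots> = exp (entropy n k)"
    using assms by (simp add: entropy_def algebra_simps exp_add exp_of_nat_mult)
  finally show ?thesis .
qed

lemma finite_grid [simp]: "finite (grid n)"
  by (simp add: grid_def)

lemma set_pmf_er:
  assumes "A \<in> set_pmf (er n p)"
  shows "A e \<in> {0, 1}"
proof -
  have "A \<in> PiE_dflt (grid n) 0 (\<lambda>e. set_pmf (map_pmf of_bool (bernoulli_pmf (p e))))"
    using assms by (simp add: er_def set_Pi_pmf comp_def)
  then have "e \<in> grid n \<Longrightarrow> A e \<in> of_bool ` set_pmf (bernoulli_pmf (p e))" "e \<notin> grid n \<Longrightarrow> A e = 0"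
    unfolding PiE_dflt_def by (auto simp del: split_paired_All)
  then show ?thesis by (cases "e \<in> grid n") auto
qed

lemma finite_set_pmf_er: "finite (set_pmf (er n p))"
  unfolding er_def by (subst set_Pi_pmf) (auto intro!: finite_PiE_dflt)

lemma mean_er:
  assumes "e \<in> grid n" "0 \<le> p e" "p e \<le> 1"
  shows "mean (er n p) e = p e"
proof -
  have "mean (er n p) e = measure_pmf.expectation (map_pmf (\<lambda>f. f e) (er n p)) (\<lambda>x. x)"
    by (simp add: mean_def)
  also have "map_pmf (\<lambda>f. f e) (er n p) = map_pmf of_bool (bernoulli_pmf (p e))"
    unfolding er_def using assms by (subst Pi_pmf_component) auto
  finally show ?thesis using assms by simp
qed

text \<open>Markov's inequality for the exponential moment, with \<open>1 + z \<le> exp z\<close> in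
  each factor. The Chernoff parameter is absorbed into the weights \<open>w\<close>, which may have
  either sign: edge counts use a constant on a set, light pairs use rescaled products
  \<open>x i * y j\<close>.\<close>

lemma er_exponential_tail:
  assumes p: "\<And>e. e \<in> grid n \<Longrightarrow> 0 \<le> p e \<and> p e \<le> 1"
  shows "measure_pmf.prob (er n p) {A. (\<Sum>e\<in>grid n. w e * A e) \<ge> t}
    \<le> exp ((\<Sum>e\<in>grid n. p e * (exp (w e) - 1)) - t)"
proof -
  let ?S = "\<lambda>A. \<Sum>e\<in>grid n. w e * A e"
  have "measure_pmf.expectation (er n p) (\<lambda>A. exp (?S A)) =
        measure_pmf.expectation (er n p) (\<lambda>A. \<Prod>e\<in>grid n. exp (w e * A e))"
    by (simp add: exp_sum)
  also have "\<dots> = (\<Prod>e\<in>grid n. measure_pmf.expectation (map_pmf of_bool (bernoulli_pmf (p e)))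
      (\<lambda>x. exp (w e * x)))"
    unfolding er_def by (intro expectation_prod_Pi_pmf) (auto intro!: integrable_measure_pmf_finite)
  also have "\<dots> = (\<Prod>e\<in>grid n. 1 + p e * (exp (w e) - 1))"
    using p by (intro prod.cong) (auto simp: algebra_simps)
  also have "\<dots> \<le> (\<Prod>e\<in>grid n. exp (p e * (exp (w e) - 1)))"
  proof (intro prod_mono conjI)
    fix e assume e: "e \<in> grid n"
    have "0 \<le> (1 - p e) + p e * exp (w e)" using p[OF e] by auto
    then show "0 \<le> 1 + p e * (exp (w e) - 1)" by (simp add: algebra_simps)
    show "1 + p e * (exp (w e) - 1) \<le> exp (p e * (exp (w e) - 1))"
      by (rule exp_ge_add_one_self)
  qed
  also have "\<dots> = exp (\<Sum>e\<in>grid n. p e * (exp (w e) - 1))"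
    by (simp add: exp_sum)
  finally have E: "measure_pmf.expectation (er n p) (\<lambda>A. exp (?S A)) \<le> \<dots>" .
  have "measure_pmf.prob (er n p) {A. ?S A \<ge> t} =
      measure_pmf.prob (er n p) {A \<in> space (er n p). exp (?S A) \<ge> exp t}"
    by simp
  also have "\<dots> \<le> measure_pmf.expectation (er n p) (\<lambda>A. exp (?S A)) / exp t"
    by (intro integral_Markov_inequality_measure[where A = "{}"])
       (auto intro: integrable_measure_pmf_finite finite_set_pmf_er)
  also have "\<dots> \<le> exp (\<Sum>e\<in>grid n. p e * (exp (w e) - 1)) / exp t"
    using E by (intro divide_right_mono) auto
  finally show ?thesis by (simp add: exp_diff)
qed

text \<open>Poisson-type tail \<open>(e * \<mu> / s)^s\<close>, where
  \<open>\<mu> = card S * d / n\<close> only bounds the mean from above. The optimal parameter is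
  \<open>\<theta> = ln (s / \<mu>)\<close>; the factor \<open>exp (- \<mu>)\<close> is given
  away.\<close>

lemma er_edge_count_tail:
  assumes p: "\<And>e. e \<in> grid n \<Longrightarrow> 0 \<le> p e \<and> p e \<le> 1 \<and> real n * p e \<le> d"
    and n: "n \<ge> 1" and d: "d > 0" and S: "S \<subseteq> grid n" "S \<noteq> {}"
    and s: "exp 1 * (real (card S) * d / n) \<le> s"
  shows "measure_pmf.prob (er n p) {A. (\<Sum>e\<in>S. A e) \<ge> s}
    \<le> exp (- (s * ln (s / (exp 1 * (real (card S) * d / n)))))"
proof -
  define \<mu> where "\<mu> = real (card S) * d / n"
  have fin: "finite S" using S finite_grid finite_subset by blast
  have \<mu>: "\<mu> > 0" using n d S fin by (simp add: \<mu>_def card_gt_0_iff)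
  have "1 * \<mu> \<le> exp 1 * \<mu>" using \<mu> by (intro mult_right_mono) auto
  then have s1: "s \<ge> \<mu>" "s > 0" using s \<mu> unfolding \<mu>_def[symmetric] by linarith+
  define \<theta> where "\<theta> = ln (s / \<mu>)"
  have \<theta>: "\<theta> \<ge> 0" "exp \<theta> = s / \<mu>" using s1 \<mu> by (auto simp: \<theta>_def)
  define w where "w e = (if e \<in> S then \<theta> else 0)" for e
  have "measure_pmf.prob (er n p) {A. (\<Sum>e\<in>S. A e) \<ge> s} \<le>
        measure_pmf.prob (er n p) {A. (\<Sum>e\<in>grid n. w e * A e) \<ge> \<theta> * s}"
  proof (intro measure_pmf.finite_measure_mono)
    have "(\<Sum>e\<in>grid n. w e * A e) = \<theta> * (\<Sum>e\<in>S. A e)" for A :: matrix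
      unfolding sum_distrib_left w_def using S
      by (intro sum.mono_neutral_cong_right) auto
    then show "{A. (\<Sum>e\<in>S. A e) \<ge> s} \<subseteq> {A. (\<Sum>e\<in>grid n. w e * A e) \<ge> \<theta> * s}"
      using \<theta> by (auto intro: mult_left_mono)
  qed auto
  also have "\<dots> \<le> exp ((\<Sum>e\<in>grid n. p e * (exp (w e) - 1)) - \<theta> * s)"
    using p by (intro er_exponential_tail) auto
  also have "(\<Sum>e\<in>grid n. p e * (exp (w e) - 1)) = (\<Sum>e\<in>S. p e * (exp \<theta> - 1))"
    unfolding w_def using S by (intro sum.mono_neutral_cong_right) auto
  also have "\<dots> \<le> (\<Sum>e\<in>S. d / n * (exp \<theta> - 1))"
    using p S n \<theta>(1) by (intro sum_mono mult_right_mono) (auto simp: field_simps)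
  also have "\<dots> = \<mu> * (exp \<theta> - 1)" by (simp add: \<mu>_def)
  also have "\<dots> = s - \<mu>" using \<mu> by (simp add: \<theta> field_simps)
  also have "exp (s - \<mu> - \<theta> * s) \<le> exp (s - \<theta> * s)" using \<mu> by simp
  also have "s - \<theta> * s = - (s * ln (s / (exp 1 * \<mu>)))"
    using s1 \<mu> by (simp add: \<theta>_def ln_div ln_mult algebra_simps)
  finally show ?thesis by (simp add: \<mu>_def)
qed

subsection \<open>A dyadic net\<close>

text \<open>The lowest level is \<open>1 / (4 * sqrt n)\<close>: rounding all smaller coordinates to
  0 costs at most \<open>1 / 16\<close> in squared norm.\<close>

definition level :: "nat \<Rightarrow> nat \<Rightarrow> real" where
  "level n s = 2 ^ s / (4 * sqrt n)"

text \<open>Level \<open>n + 2\<close> already exceeds 1. So generous a range is harmless, since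
  every later sum over levels is bounded independently of their number.\<close>

definition net_values :: "nat \<Rightarrow> real set" where
  "net_values n = insert 0 (level n ` {..n + 2} \<union> (\<lambda>s. - level n s) ` {..n + 2})"

definition dyadic_net :: "nat \<Rightarrow> (nat \<Rightarrow> real) set" where
  "dyadic_net n = {x \<in> {1..n} \<rightarrow>\<^sub>E net_values n. (\<Sum>i=1..n. (x i)\<^sup>2) \<le> 1}"

lemma level_pos: "n \<ge> 1 \<Longrightarrow> level n s > 0"
  by (simp add: level_def)

lemma finite_net_values: "finite (net_values n)"
  by (simp add: net_values_def)

lemma finite_dyadic_net: "finite (dyadic_net n)"
  unfolding dyadic_net_def
  by (rule finite_subset[of _ "{1..n} \<rightarrow>\<^sub>E net_values n"]) (auto intro: finite_PiE finite_net_values)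

lemma net_values_round:
  assumes n: "n \<ge> 1" and z: "\<bar>z\<bar> \<le> 1"
  obtains w where "w \<in> net_values n" "\<bar>w\<bar> \<le> \<bar>z\<bar>" "(z - w)\<^sup>2 \<le> z\<^sup>2 / 4 + 1 / (16 * n)"
proof -
  have pos: "\<exists>w \<in> insert 0 (level n ` {..n + 2}). 0 \<le> w \<and> w \<le> y \<and> (y - w)\<^sup>2 \<le> y\<^sup>2 / 4 + 1 / (16 * n)"
    if y: "0 \<le> y" "y \<le> 1" for y :: real
  proof (cases "y < level n 0")
    case True
    have "y\<^sup>2 \<le> (level n 0)\<^sup>2" using True y by (intro power_mono) auto
    also have "\<dots> = 1 / (16 * n)" using n by (simp add: level_def power_divide power_mult_distrib)
    finally have "y\<^sup>2 \<le> y\<^sup>2 / 4 + 1 / (16 * n)" using zero_le_power2[of y] by linarith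
    then show ?thesis using y by (intro bexI[of _ 0]) auto
  next
    case False
    define P where "P s \<longleftrightarrow> level n s \<le> y" for s
    have "P 0" using False by (simp add: P_def)
    have bound: "s \<le> n + 2" if "P s" for s
    proof -
      have "level n s \<le> 1" using that y by (simp add: P_def)
      then have "2 ^ s \<le> 4 * sqrt n" using n by (simp add: level_def field_simps)
      also have "\<dots> \<le> 4 * real n"
      proof -
        have "sqrt n \<le> sqrt (real n * real n)" using n by (intro real_sqrt_le_mono) auto
        then show ?thesis by simp
      qed
      also have "\<dots> < 4 * 2 ^ n" using of_nat_less_two_power[of n, where 'a = real] by simp
      finally have "(2::real) ^ s < 2 ^ (n + 2)" by (simp add: power_add)
      then have "s < n + 2" by (subst (asm) power_strict_increasing_iff) auto
      then show ?thesis by simp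
    qed
    \<comment> \<open>Rounding down to the largest level not above \<open>y\<close>: as
      \<open>y\<close> is less than twice that level, the error is at most
      \<open>y / 2\<close>.\<close>
    define s where "s = (GREATEST s. P s)"
    have s: "P s" unfolding s_def using \<open>P 0\<close> bound by (rule GreatestI_nat)
    have "\<not> P (Suc s)" using Greatest_le_nat[of P "Suc s" "n + 2"] bound unfolding s_def by fastforce
    then have w: "y < 2 * level n s" by (simp add: P_def level_def)
    have w': "level n s \<le> y" using s by (simp add: P_def)
    have "(y - level n s)\<^sup>2 \<le> (y / 2)\<^sup>2" using w w' by (intro power_mono) auto
    then have "(y - level n s)\<^sup>2 \<le> y\<^sup>2 / 4 + 1 / (16 * n)"
      by (simp add: power_divide add_increasing2)
    then show ?thesis using bound[OF s] w' level_pos[OF n, of s]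
      by (intro bexI[of _ "level n s"]) auto
  qed
  obtain w where w: "w \<in> insert 0 (level n ` {..n + 2})" "0 \<le> w" "w \<le> \<bar>z\<bar>"
    "(\<bar>z\<bar> - w)\<^sup>2 \<le> z\<^sup>2 / 4 + 1 / (16 * n)"
    using pos[of "\<bar>z\<bar>"] z unfolding power2_abs by (metis abs_ge_zero)
  show ?thesis
  proof (cases "z \<ge> 0")
    case True
    then show ?thesis using w by (intro that[of w]) (auto simp: net_values_def)
  next
    case False
    have "(z - (- w))\<^sup>2 = (\<bar>z\<bar> - w)\<^sup>2" using False by (simp add: power2_eq_square algebra_simps)
    then show ?thesis using w by (intro that[of "- w"]) (auto simp: net_values_def)
  qed
qed

text \<open>Rounding towards 0 keeps the vector in the unit ball. The squared errors sum to at most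
  \<open>1 / 4\<close> (relative error \<open>1 / 2\<close>) plus \<open>n * (1 / (16 * n))\<close>
  (coordinates below the lowest level).\<close>

lemma dyadic_net_approx:
  assumes n: "n \<ge> 1" and x: "(\<Sum>i=1..n. (x i)\<^sup>2) \<le> 1"
  obtains x' where "x' \<in> dyadic_net n" "(\<Sum>i=1..n. (x i - x' i)\<^sup>2) \<le> 5 / 16"
proof -
  have "\<bar>x i\<bar> \<le> 1" if "i \<in> {1..n}" for i
  proof -
    have "(x i)\<^sup>2 \<le> (\<Sum>i=1..n. (x i)\<^sup>2)" using that by (intro member_le_sum) auto
    then have "(x i)\<^sup>2 \<le> 1" using x by linarith
    then show ?thesis by (simp only: abs_square_le_1)
  qed
  then have "\<forall>i\<in>{1..n}. \<exists>w. w \<in> net_values n \<and> \<bar>w\<bar> \<le> \<bar>x i\<bar> \<and> (x i - w)\<^sup>2 \<le> (x i)\<^sup>2 / 4 + 1 / (16 * n)"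
    by (meson net_values_round[OF n])
  then obtain f where f: "\<And>i. i \<in> {1..n} \<Longrightarrow> f i \<in> net_values n \<and> \<bar>f i\<bar> \<le> \<bar>x i\<bar> \<and>
      (x i - f i)\<^sup>2 \<le> (x i)\<^sup>2 / 4 + 1 / (16 * n)"
    by metis
  define x' where "x' = restrict f {1..n}"
  have "(\<Sum>i=1..n. (x' i)\<^sup>2) \<le> (\<Sum>i=1..n. (x i)\<^sup>2)"
    using f by (intro sum_mono) (auto simp: x'_def abs_le_square_iff)
  then have "x' \<in> dyadic_net n" using x f by (auto simp: dyadic_net_def x'_def)
  moreover have "(\<Sum>i=1..n. (x i - x' i)\<^sup>2) \<le> (\<Sum>i=1..n. (x i)\<^sup>2 / 4 + 1 / (16 * n))"
    using f by (intro sum_mono) (auto simp: x'_def)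
  then have "(\<Sum>i=1..n. (x i - x' i)\<^sup>2) \<le> 5 / 16"
    using x n by (simp add: sum.distrib flip: sum_divide_distrib)
  ultimately show ?thesis by (rule that)
qed

text \<open>The approximation error of a maximiser, here \<open>c / \<parallel>c\<parallel>\<close>, is absorbed into the left-hand side.\<close>

lemma L2_set_le_dyadic_net:
  assumes n: "n \<ge> 1" and b: "\<And>x. x \<in> dyadic_net n \<Longrightarrow> (\<Sum>i=1..n. c i * x i) \<le> b"
  shows "L2_set c {1..n} \<le> 5 / 2 * b"
proof (cases "L2_set c {1..n} = 0")
  case True
  have "(\<lambda>i\<in>{1..n}. 0) \<in> dyadic_net n" by (auto simp: dyadic_net_def net_values_def)
  from b[OF this] have "0 \<le> b" by simp
  then show ?thesis using True by simp
next
  case False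
  define l where "l = L2_set c {1..n}"
  have l: "l > 0" using False L2_set_nonneg[of c "{1..n}"] unfolding l_def by linarith
  have l2: "l\<^sup>2 = (\<Sum>i=1..n. (c i)\<^sup>2)"
    unfolding l_def L2_set_def by (simp add: sum_nonneg)
  define x where "x i = c i / l" for i
  have "(\<Sum>i=1..n. (x i)\<^sup>2) = (\<Sum>i=1..n. (c i)\<^sup>2) / l\<^sup>2"
    by (simp add: x_def power_divide sum_divide_distrib)
  also have "\<dots> = 1" unfolding l2[symmetric] using l by simp
  finally obtain x' where x': "x' \<in> dyadic_net n" "(\<Sum>i=1..n. (x i - x' i)\<^sup>2) \<le> 5 / 16"
    using dyadic_net_approx[OF n, of x] by auto
  have "(\<Sum>i=1..n. c i * x i) = (\<Sum>i=1..n. (c i)\<^sup>2) / l"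
    by (simp add: x_def power2_eq_square sum_divide_distrib)
  also have "\<dots> = l\<^sup>2 / l" by (simp only: l2)
  also have "\<dots> = l" using l by (simp add: power2_eq_square)
  finally have "l = (\<Sum>i=1..n. c i * x i)" by (rule sym)
  also have "\<dots> = (\<Sum>i=1..n. c i * x' i) + (\<Sum>i=1..n. c i * (x i - x' i))"
    by (simp add: algebra_simps flip: sum.distrib)
  also have "(\<Sum>i=1..n. c i * (x i - x' i)) \<le> (\<Sum>i=1..n. \<bar>c i\<bar> * \<bar>x i - x' i\<bar>)"
    by (intro sum_mono) (metis abs_ge_self abs_mult)
  also have "\<dots> \<le> l * L2_set (\<lambda>i. x i - x' i) {1..n}"
    unfolding l_def by (rule L2_set_mult_ineq)
  \<comment> \<open>\<open>5 / 16 \<le> 9 / 25\<close>; the rational bound \<open>3 / 5\<close>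
    yields the factor \<open>1 / (1 - 3 / 5) = 5 / 2\<close>.\<close>
  also have "L2_set (\<lambda>i. x i - x' i) {1..n} \<le> sqrt ((3 / 5)\<^sup>2)"
    unfolding L2_set_def using x'(2) by (intro real_sqrt_le_mono) (simp add: power2_eq_square)
  also have "(\<Sum>i=1..n. c i * x' i) \<le> b" by (rule b) fact
  finally have "l \<le> b + l * (3 / 5)" using l by simp
  then show ?thesis by (simp add: l_def)
qed

text \<open>The passage from the net to the ball is made twice, for the column vector
  \<open>c\<close> obtained from a fixed net point \<open>x\<close> and for the image of
  \<open>y\<close>; each costs \<open>5 / 2\<close>.\<close>

lemma spectral_norm_le_dyadic_net:
  assumes n: "n \<ge> 1"
    and b: "\<And>x y. x \<in> dyadic_net n \<Longrightarrow> y \<in> dyadic_net n \<Longrightarrow> (\<Sum>i=1..n. \<Sum>j=1..n. x i * B (i, j) * y j) \<le> b"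
  shows "spectral_norm n B \<le> 25 / 4 * b"
  unfolding spectral_norm_def
proof (rule cSUP_least)
  have "(\<lambda>_. 0) \<in> {x. L2_set x {1..n} \<le> 1}" by (simp add: L2_set_def)
  then show "{x. L2_set x {1..n} \<le> 1} \<noteq> {}" by blast
next
  fix y assume "y \<in> {x. L2_set x {1..n} \<le> 1}"
  then have y: "L2_set y {1..n} \<le> 1" by simp
  have "(\<Sum>i=1..n. (\<Sum>j=1..n. B (i, j) * y j) * x i) \<le> 5 / 2 * b" if x: "x \<in> dyadic_net n" for x
  proof -
    define c where "c j = (\<Sum>i=1..n. x i * B (i, j))" for j
    have "L2_set c {1..n} \<le> 5 / 2 * b"
    proof (rule L2_set_le_dyadic_net[OF n])
      fix y' assume "y' \<in> dyadic_net n"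
      from b[OF x this] show "(\<Sum>j=1..n. c j * y' j) \<le> b"
        unfolding c_def sum_distrib_right by (subst sum.swap) simp
    qed
    have "(\<Sum>i=1..n. (\<Sum>j=1..n. B (i, j) * y j) * x i) = (\<Sum>j=1..n. c j * y j)"
      unfolding c_def sum_distrib_right by (subst sum.swap) (simp add: mult_ac)
    also have "\<dots> \<le> (\<Sum>j=1..n. \<bar>c j\<bar> * \<bar>y j\<bar>)"
      by (intro sum_mono) (metis abs_ge_self abs_mult)
    also have "\<dots> \<le> L2_set c {1..n} * L2_set y {1..n}"
      by (rule L2_set_mult_ineq)
    also have "\<dots> \<le> L2_set c {1..n} * 1" using y by (intro mult_left_mono) auto
    finally show ?thesis using \<open>L2_set c {1..n} \<le> 5 / 2 * b\<close> by simp
  qed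
  from L2_set_le_dyadic_net[OF n this]
  show "L2_set (\<lambda>i. \<Sum>j=1..n. B (i, j) * y j) {1..n} \<le> 25 / 4 * b" by simp
qed

lemma dyadic_net_zero_out:
  assumes "x \<in> dyadic_net n"
  shows "(\<lambda>i\<in>{1..n}. if i \<in> I then 0 else x i) \<in> dyadic_net n" (is "?x \<in> _")
proof -
  have "(\<Sum>i=1..n. (?x i)\<^sup>2) \<le> (\<Sum>i=1..n. (x i)\<^sup>2)" by (intro sum_mono) auto
  moreover have "0 \<in> net_values n" by (simp add: net_values_def)
  ultimately show ?thesis using assms by (auto simp: dyadic_net_def PiE_iff)
qed

text \<open>Counting by weights: with \<open>g v = exp (- 16 * n * v^2)\<close>, each net point has
  \<open>exp (16 * n)\<close> times the product of its \<open>g (x i)\<close> at least 1, because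
  its squared norm is at most 1. Summed over all functions into \<open>net_values n\<close>, the
  product factorises, and each coordinate contributes at most \<open>3 \<le> exp 2\<close>. Raising
  the number of values to the power \<open>n\<close> would not give a bound exponential in
  \<open>n\<close>.\<close>

lemma card_dyadic_net:
  assumes n: "n \<ge> 1"
  shows "real (card (dyadic_net n)) \<le> exp (18 * n)"
proof -
  define g where "g v = exp (- (16 * n * v\<^sup>2))" for v :: real
  \<comment> \<open>\<open>g (level n s) = exp (- t^2)\<close> with \<open>t = 2 ^ s\<close>, and
    \<open>2 * t \<le> 1 + t^2 \<le> exp (t^2)\<close>.\<close>
  have lev: "g (level n s) \<le> (1 / 2) ^ Suc s" for s
  proof -
    have "2 * (2::real) ^ s \<le> 1 + (2 ^ s)\<^sup>2"
      using zero_le_power2[of "2 ^ s - 1 :: real"] by (simp add: power2_eq_square algebra_simps)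
    also have "\<dots> \<le> exp ((2 ^ s)\<^sup>2)" using exp_ge_add_one_self by blast
    finally have "2 * 2 ^ s \<le> exp ((2 ^ s)\<^sup>2 :: real)" .
    then have "1 / exp ((2 ^ s)\<^sup>2 :: real) \<le> 1 / (2 * 2 ^ s)"
      by (intro divide_left_mono) auto
    moreover have "g (level n s) = 1 / exp ((2 ^ s)\<^sup>2)"
      using n by (simp add: g_def level_def power_divide power_mult_distrib exp_minus field_simps)
    ultimately show ?thesis by (simp add: power_divide)
  qed
  have geo: "(\<Sum>s\<le>m. g (level n s)) \<le> 1" for m
  proof -
    have "(\<Sum>s\<le>m. g (level n s)) \<le> (\<Sum>s\<le>m. (1 / 2) ^ Suc s)" by (intro sum_mono lev)
    also have "\<dots> = 1 - (1 / 2) ^ Suc m" by (induction m) auto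
    also have "\<dots> \<le> 1" by simp
    finally show ?thesis .
  qed
  have "sum g (net_values n) \<le> g 0 + (\<Sum>v\<in>level n ` {..n + 2}. g v) + (\<Sum>v\<in>(\<lambda>s. - level n s) ` {..n + 2}. g v)"
  proof -
    let ?P = "level n ` {..n + 2}" and ?N = "(\<lambda>s. - level n s) ` {..n + 2}"
    have g: "g v \<ge> 0" for v by (simp add: g_def)
    have "sum g (net_values n) \<le> g 0 + sum g (?P \<union> ?N)"
      unfolding net_values_def using g[of 0] by (cases "0 \<in> ?P \<union> ?N") (auto simp: insert_absorb)
    moreover have "sum g (?P \<union> ?N) + sum g (?P \<inter> ?N) = sum g ?P + sum g ?N"
      by (intro sum.union_inter) auto
    moreover have "sum g (?P \<inter> ?N) \<ge> 0" using g by (intro sum_nonneg) auto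
    ultimately show ?thesis by linarith
  qed
  also have "\<dots> \<le> 1 + (\<Sum>s\<le>n+2. g (level n s)) + (\<Sum>s\<le>n+2. g (- level n s))"
    by (intro add_mono order.trans[OF sum_image_le]) (auto simp: g_def)
  also have "\<dots> \<le> 3" using geo[of "n + 2"] by (simp add: g_def)
  also have "3 \<le> exp (2::real)" using exp_ge_add_one_self[of "2::real"] by simp
  finally have V: "sum g (net_values n) \<le> exp 2" .
  have "real (card (dyadic_net n)) = (\<Sum>x\<in>dyadic_net n. 1)" by simp
  also have "\<dots> \<le> (\<Sum>x\<in>dyadic_net n. exp (16 * n) * (\<Prod>i=1..n. g (x i)))"
  proof (intro sum_mono)
    fix x assume x: "x \<in> dyadic_net n"
    have "(\<Prod>i=1..n. g (x i)) = exp (- (16 * n * (\<Sum>i=1..n. (x i)\<^sup>2)))"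
      by (simp add: g_def sum_distrib_left flip: exp_sum sum_negf)
    then show "1 \<le> exp (16 * n) * (\<Prod>i=1..n. g (x i))"
      using x n by (simp add: dyadic_net_def mult_left_le flip: exp_add)
  qed
  also have "\<dots> \<le> (\<Sum>x\<in>{1..n} \<rightarrow>\<^sub>E net_values n. exp (16 * n) * (\<Prod>i=1..n. g (x i)))"
    by (intro sum_mono2 finite_PiE mult_nonneg_nonneg prod_nonneg)
       (auto simp: dyadic_net_def finite_net_values g_def)
  also have "\<dots> = exp (16 * n) * (\<Prod>i=1..n. sum g (net_values n))"
    by (subst prod_sum_PiE) (auto simp: finite_net_values simp flip: sum_distrib_left)
  also have "\<dots> \<le> exp (16 * n) * (\<Prod>i=1..n. exp 2)"
    using V by (intro mult_left_mono prod_mono) (auto intro!: sum_nonneg simp: g_def)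
  also have "\<dots> = exp (18 * real n)" by (simp flip: exp_of_nat_mult exp_add)
  finally show ?thesis .
qed

subsection \<open>Heavy pairs\<close>

text \<open>The threshold \<open>7 r entropy\<close> is what a union bound over all pairs \<open>I\<close>, \<open>J\<close> and all values of the
  edge count can afford against the Chernoff tail \<open>exp (- s ln (s / (e \<mu>)))\<close>.\<close>

definition discrepancy :: "nat \<Rightarrow> real \<Rightarrow> real \<Rightarrow> matrix \<Rightarrow> bool" where
  "discrepancy n d r A \<longleftrightarrow> (\<forall>I J. I \<subseteq> {1..n} \<longrightarrow> J \<subseteq> {1..n} \<longrightarrow> I \<noteq> {} \<longrightarrow> J \<noteq> {} \<longrightarrow>
     exp 1 * (real (card I) * real (card J) * d / n) < sum A (I \<times> J) \<longrightarrow>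
     sum A (I \<times> J) * ln (sum A (I \<times> J) / (exp 1 * (real (card I) * real (card J) * d / n)))
       \<le> 7 * r * entropy n (max (real (card I)) (real (card J))))"

text \<open>Bound for the contribution of the rows of level \<open>u\<close> (there are \<open>a\<close> of them) and the columns of
  level \<open>v\<close>. Each summand is a geometric progression in \<open>v\<close>, truncated where it is largest, so that
  summing over \<open>v\<close> leaves \<open>r \<surd>d (a u\<^sup>2)\<close>. The summands correspond to: the degree bound, the
  discrepancy with \<open>e = O(r a)\<close>, the discrepancy with \<open>e = O(r a u \<surd>n)\<close>, and a moderate ratio of the
  edge count to its mean.\<close>

definition heavy_bound :: "nat \<Rightarrow> real \<Rightarrow> real \<Rightarrow> real \<Rightarrow> real \<Rightarrow> real \<Rightarrow> real" where
  "heavy_bound n d r a u v =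
     (if v * sqrt d \<le> u then 8 * r * d * a * u * v else 0) +
     (if v \<le> sqrt d * u then 28 * r * a * u * v else 0) +
     (if v \<le> 2 * sqrt d / sqrt n then 28 * r * sqrt n * a * u\<^sup>2 * v else 0) +
     (if v \<ge> sqrt d / n / u then 4 * (d / n) * a * u * (1 / v) else 0)"

lemma heavy_bound_ge:
  assumes "r \<ge> 0" "d \<ge> 0" "a \<ge> 0" "u > 0" "v > 0"
  shows "0 \<le> heavy_bound n d r a u v"
    and "v * sqrt d \<le> u \<Longrightarrow> 8 * r * d * a * u * v \<le> heavy_bound n d r a u v"
    and "v \<le> sqrt d * u \<Longrightarrow> 28 * r * a * u * v \<le> heavy_bound n d r a u v"
    and "v \<le> 2 * sqrt d / sqrt n \<Longrightarrow> 28 * r * sqrt n * a * u\<^sup>2 * v \<le> heavy_bound n d r a u v"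
    and "v \<ge> sqrt d / n / u \<Longrightarrow> 4 * (d / n) * a * u * (1 / v) \<le> heavy_bound n d r a u v"
proof -
  have "0 \<le> 8 * r * d * a * u * v" "0 \<le> 28 * r * a * u * v"
    "0 \<le> 28 * r * sqrt n * a * u\<^sup>2 * v" "0 \<le> 4 * (d / n) * a * u * (1 / v)"
    using assms by auto
  then show "0 \<le> heavy_bound n d r a u v"
    and "v * sqrt d \<le> u \<Longrightarrow> 8 * r * d * a * u * v \<le> heavy_bound n d r a u v"
    and "v \<le> sqrt d * u \<Longrightarrow> 28 * r * a * u * v \<le> heavy_bound n d r a u v"
    and "v \<le> 2 * sqrt d / sqrt n \<Longrightarrow> 28 * r * sqrt n * a * u\<^sup>2 * v \<le> heavy_bound n d r a u v"
    and "v \<ge> sqrt d / n / u \<Longrightarrow> 4 * (d / n) * a * u * (1 / v) \<le> heavy_bound n d r a u v"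
    unfolding heavy_bound_def by (smt (verit))+
qed

lemma power4_le_imp_le: "a ^ 4 \<le> b ^ 4 \<Longrightarrow> 0 \<le> b \<Longrightarrow> a \<le> (b::real)"
  using power_le_imp_le_base[of a 3 b] by (simp add: eval_nat_numeral)

lemma exp_1_le_3: "exp (1::real) \<le> 3"
  using exp_le by simp

text \<open>Here \<open>a\<close> is the longer side, so the entropy in \<open>disc\<close> is that
  of \<open>a\<close>. Each case must end in a bound that sums over all pairs of levels: either the
  product of the masses \<open>a * u^2\<close> and \<open>b * v^2\<close>, or a progression in one
  level cut off at its largest term. The cases depend on the ratio \<open>u / v\<close>, on the
  excess \<open>l\<close> of the edge count over e times its mean, and on the size of
  \<open>u\<close> relative to \<open>1 / sqrt n\<close>.\<close>

lemma heavy_pair_aux: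
  fixes n :: nat and d r a b u v e :: real
  assumes n: "n \<ge> 1" and d: "d \<ge> 1" and r: "r \<ge> 1"
    and ab: "0 < b" "b \<le> a" "a \<le> n" and uv: "u > 0" "v > 0"
    and au: "a * u\<^sup>2 \<le> 1" and heavy: "sqrt d / n \<le> u * v"
    and e: "0 \<le> e" "e \<le> 8 * r * d * a" "e \<le> 8 * r * d * b"
    and disc: "exp 1 * (a * b * d / n) < e \<Longrightarrow>
      e * ln (e / (exp 1 * (a * b * d / n))) \<le> 7 * r * entropy n a"
  shows "e * u * v \<le> 27 * sqrt d * (a * u\<^sup>2) * (b * v\<^sup>2)
    + heavy_bound n d r a u v + heavy_bound n d r b v u"
proof -
  have a: "a > 0" and n0: "real n > 0" using ab n by auto
  have sd: "sqrt d > 0" "sqrt d * sqrt d = d" using d by auto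
  have main0: "27 * sqrt d * (a * u\<^sup>2) * (b * v\<^sup>2) \<ge> 0" using d a ab by simp
  note G1 = heavy_bound_ge[of r d a u v n] and G2 = heavy_bound_ge[of r d b v u n]
  have "0 \<le> heavy_bound n d r a u v" "0 \<le> heavy_bound n d r b v u"
    using r d a ab uv by (auto intro: heavy_bound_ge(1))
  note G = this main0
  define \<mu> where "\<mu> = a * b * d / n"
  have \<mu>: "\<mu> > 0" using a ab d n0 by (simp add: \<mu>_def)
  have heavy': "1 \<le> u * v * n / sqrt d" using heavy n0 sd by (simp add: field_simps)
  \<comment> \<open>An edge count exceeding the mean by no more than a multiple of the heaviness
    \<open>u * v * n / sqrt d \<ge> 1\<close> gives the product of the two masses.\<close>
  have low: "e * u * v \<le> 27 * sqrt d * (a * u\<^sup>2) * (b * v\<^sup>2)"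
    if "e \<le> \<mu> * (9 * (u * v * n / sqrt d))"
  proof -
    have "e * u * v \<le> \<mu> * (9 * (u * v * n / sqrt d)) * u * v"
      using that uv by (intro mult_right_mono) auto
    also have "\<dots> = 9 * sqrt d * (a * u\<^sup>2) * (b * v\<^sup>2)"
      using sd n0 by (simp add: \<mu>_def power2_eq_square field_simps)
    also have "\<dots> \<le> 27 * sqrt d * (a * u\<^sup>2) * (b * v\<^sup>2)"
      using sd a ab by (intro mult_right_mono) auto
    finally show ?thesis .
  qed
  \<comment> \<open>For very unequal levels the degree bound suffices: at the cut-off
    \<open>v = u / sqrt d\<close> the term \<open>d * a * u * v\<close> equals
    \<open>sqrt d * (a * u^2)\<close>. Only case C needs the discrepancy property.\<close>
  consider (A) "v * sqrt d \<le> u" | (B) "u * sqrt d \<le> v" | (C) "v < sqrt d * u" "u < sqrt d * v"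
    by (fastforce simp: mult.commute)
  then show ?thesis
  proof cases
    case A
    have "e * (u * v) \<le> 8 * r * d * a * (u * v)" using e uv by (intro mult_right_mono) auto
    moreover have "8 * r * d * a * u * v \<le> heavy_bound n d r a u v"
      using A r d a uv by (intro G1(2)) auto
    ultimately show ?thesis using G unfolding mult.assoc by linarith
  next
    case B
    have "e * (u * v) \<le> 8 * r * d * b * (u * v)" using e uv by (intro mult_right_mono) auto
    moreover have "8 * r * d * b * v * u \<le> heavy_bound n d r b v u"
      using B r d ab uv by (intro G2(2)) auto
    ultimately show ?thesis using G unfolding mult.assoc mult.commute[of v u] by linarith
  next
    case C
    define l where "l = e / (exp 1 * \<mu>)"
    have el: "e = l * (exp 1 * \<mu>)" using \<mu> by (simp add: l_def)
    have le3: "e \<le> 3 * l * \<mu>" if "l \<ge> 0"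
      using exp_1_le_3 \<mu> that unfolding el by (simp add: mult_mono mult_ac)
    show ?thesis
    proof (cases "l \<le> 3")
      case True
      have "l \<ge> 0" using e \<mu> by (simp add: l_def)
      then have "e \<le> 3 * l * \<mu>" by (rule le3)
      also have "\<dots> \<le> 9 * \<mu>" using True \<mu> by (intro mult_right_mono) auto
      also have "\<dots> \<le> \<mu> * (9 * (u * v * n / sqrt d))"
        using mult_left_mono[OF heavy', of "9 * \<mu>"] \<mu> by (simp add: mult_ac)
      finally have "e \<le> \<mu> * (9 * (u * v * n / sqrt d))" .
      from low[OF this] show ?thesis using G by linarith
    next
      case False
      then have l: "l > 3" by simp
      have "1 = ln (exp (1::real))" by simp
      also have "\<dots> \<le> ln l" using exp_1_le_3 l by (intro ln_mono) auto
      finally have lnl: "ln l \<ge> 1" .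
      define E where "E = 1 + ln (n / a)"
      have E: "E \<ge> 1" using ab a by (simp add: E_def)
      have expE: "exp E = exp 1 * (n / a)" using a n0 by (simp add: E_def exp_add)
      have "exp 1 * \<mu> < e" using l \<mu> by (simp add: el)
      then have dis: "e * ln l \<le> 7 * r * (a * E)"
        using disc unfolding \<mu>_def[symmetric] l_def[symmetric] by (simp add: entropy_def E_def)
      \<comment> \<open>If \<open>ln l\<close> is comparable with the entropy factor
        \<open>E\<close>, the two cancel in \<open>dis\<close> and leave
        \<open>e \<le> 28 * r * a\<close>. Otherwise \<open>l^4\<close> is at most of order
        \<open>n / a\<close>.\<close>
      show ?thesis
      proof (cases "E \<le> 4 * ln l")
        case True
        have "e * E \<le> e * (4 * ln l)" using True e by (intro mult_left_mono) auto
        also have "\<dots> \<le> 28 * r * a * E" using dis by (simp add: mult_ac)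
        finally have "e \<le> 28 * r * a" using E by simp
        then have "e * (u * v) \<le> 28 * r * a * (u * v)" using uv by (intro mult_right_mono) auto
        moreover have "28 * r * a * u * v \<le> heavy_bound n d r a u v"
          using C r d a uv by (intro G1(3)) auto
        ultimately show ?thesis using G unfolding mult.assoc by linarith
      next
        case False
        then have "exp (4 * ln l) \<le> exp E" by simp
        moreover have "exp (4 * ln l) = l ^ 4"
          using l exp_of_nat_mult[of 4 "ln l"] by simp
        moreover have "exp E \<le> 3 * (n / a)"
          unfolding expE using exp_1_le_3 a n0 by (intro mult_right_mono) auto
        ultimately have l4: "l ^ 4 \<le> 3 * (n / a)" by simp
        \<comment> \<open>The quantity \<open>n * a * u^4\<close> decides whether
          \<open>l^4 \<le> 3 * (n / a)\<close> bounds \<open>l\<close> by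
          \<open>1 / (a * u^2)\<close> or by \<open>sqrt n * u\<close>, up to constants. The
          constants \<open>4 / 3\<close> and \<open>3 / 2\<close> below only need a fourth power of
          at least 3.\<close>
        show ?thesis
        proof (cases "n * a * u ^ 4 \<le> 1")
          case True
          define \<alpha> where "\<alpha> = a * u\<^sup>2"
          have \<alpha>: "\<alpha> > 0" "\<alpha> \<le> 1" using a uv au by (auto simp: \<alpha>_def)
          have "(l * \<alpha>) ^ 4 = l ^ 4 * \<alpha>\<^sup>2 * \<alpha>\<^sup>2" by (simp add: power_mult_distrib flip: power_add)
          also have "\<dots> \<le> 3 * (n / a) * \<alpha>\<^sup>2 * 1"
            using l4 \<alpha> a by (intro mult_mono) (auto simp: power_le_one)
          also have "\<dots> = 3 * (n * a * u ^ 4)"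
            using a by (simp add: \<alpha>_def power2_eq_square power4_eq_xxxx)
          also have "\<dots> \<le> (4 / 3) ^ 4" using True by (simp add: power4_eq_xxxx)
          finally have "l * \<alpha> \<le> 4 / 3"
            by (rule power4_le_imp_le) simp
          then have "(l * \<alpha>) * (3 * (d / n) * b * (v / u)) \<le> 4 / 3 * (3 * (d / n) * b * (v / u))"
            using d ab uv by (intro mult_right_mono) auto
          then have "3 * l * \<mu> * (u * v) \<le> 4 * (d / n) * b * v * (1 / u)"
            using uv n0 by (simp add: \<mu>_def \<alpha>_def power2_eq_square field_simps)
          moreover have "e * (u * v) \<le> 3 * l * \<mu> * (u * v)"
            using le3 l uv by (intro mult_right_mono) auto
          moreover have "sqrt d / n / v \<le> u" using heavy uv by (simp only: pos_divide_le_eq)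
          then have "4 * (d / n) * b * v * (1 / u) \<le> heavy_bound n d r b v u"
            using r d ab uv by (intro G2(5)) auto
          ultimately show ?thesis using G unfolding mult.assoc by linarith
        next
          case False
          then have big: "n / a < (n * u\<^sup>2)\<^sup>2"
            using a n0 by (simp add: field_simps power2_eq_square power4_eq_xxxx)
          define w where "w = sqrt n * u"
          have w: "w > 0" "w\<^sup>2 = n * u\<^sup>2" using n0 uv by (auto simp: w_def power_mult_distrib)
          have "l ^ 4 \<le> 3 * (w\<^sup>2)\<^sup>2" using l4 big w by simp
          also have "\<dots> \<le> (3 / 2 * w) ^ 4" using w(1) by (simp add: power4_eq_xxxx power2_eq_square)
          finally have lw: "l \<le> 3 / 2 * w"
            by (rule power4_le_imp_le) (use w(1) in simp)
          have w4: "w ^ 4 = (n * u\<^sup>2)\<^sup>2" unfolding w(2)[symmetric] by simp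
          have "ln (n / a) \<le> ln (w ^ 4)"
            unfolding w4 using big a n0 by (intro ln_mono) auto
          also have "\<dots> = 4 * ln w" using w(1) by (simp add: ln_realpow)
          also have "\<dots> \<le> 4 * (w - 1)" using ln_le_minus_one[of w] w(1) by simp
          finally have "E \<le> 4 * w" by (simp add: E_def)
          have "e * 1 \<le> e * ln l" using lnl e by (intro mult_left_mono) auto
          also have "\<dots> \<le> 7 * r * (a * E)" by (rule dis)
          also have "\<dots> \<le> 7 * r * (a * (4 * w))"
            using \<open>E \<le> 4 * w\<close> a r by (intro mult_left_mono) auto
          finally have "e * (u * v) \<le> 7 * r * (a * (4 * w)) * (u * v)"
            using uv by (intro mult_right_mono) auto
          then have e5: "e * u * v \<le> 28 * r * sqrt n * a * u\<^sup>2 * v"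
            by (simp add: w_def power2_eq_square mult_ac)
          \<comment> \<open>Below the cut-off for \<open>v\<close> the bound \<open>e5\<close> is a
            summable progression; above it, \<open>l \<le> 3 / 2 * w\<close> is itself dominated by
            the heaviness, and \<open>low\<close> applies.\<close>
          show ?thesis
          proof (cases "v \<le> 2 * sqrt d / sqrt n")
            case True
            then have "28 * r * sqrt n * a * u\<^sup>2 * v \<le> heavy_bound n d r a u v"
              using r d a uv by (intro G1(4)) auto
            then show ?thesis using e5 G by linarith
          next
            case False
            then have v: "1 \<le> v * sqrt n / (2 * sqrt d)" using sd n0 by (simp add: field_simps)
            have "e \<le> 3 * l * \<mu>" using le3 l by simp
            also have "\<dots> \<le> 3 * (3 / 2 * w) * \<mu>" using lw \<mu> by (intro mult_right_mono) auto
            also have "\<dots> \<le> 3 * (3 / 2 * w) * \<mu> * (v * sqrt n / (2 * sqrt d))"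
              using mult_left_mono[OF v, of "3 * (3 / 2 * w) * \<mu>"] w(1) \<mu> by simp
            also have "\<dots> = 9 / 4 * (\<mu> * (u * v * n / sqrt d))"
              using n0 by (simp add: w_def field_simps)
            also have "\<dots> \<le> 9 * (\<mu> * (u * v * n / sqrt d))"
              using \<mu> uv sd by (intro mult_right_mono) auto
            finally have "e \<le> \<mu> * (9 * (u * v * n / sqrt d))" by (simp only: mult.left_commute)
            from low[OF this] show ?thesis using G by linarith
          qed
        qed
      qed
    qed
  qed
qed

lemma heavy_pair:
  fixes n :: nat and d r a b u v e :: real
  assumes "n \<ge> 1" "d \<ge> 1" "r \<ge> 1" "0 < a" "0 < b" "a \<le> n" "b \<le> n" "u > 0" "v > 0"
    and "a * u\<^sup>2 \<le> 1" "b * v\<^sup>2 \<le> 1" "sqrt d / n \<le> u * v"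
    and "0 \<le> e" "e \<le> 8 * r * d * a" "e \<le> 8 * r * d * b"
    and disc: "exp 1 * (a * b * d / n) < e \<Longrightarrow>
      e * ln (e / (exp 1 * (a * b * d / n))) \<le> 7 * r * entropy n (max a b)"
  shows "e * u * v \<le> 27 * sqrt d * (a * u\<^sup>2) * (b * v\<^sup>2)
    + heavy_bound n d r a u v + heavy_bound n d r b v u"
proof (cases "b \<le> a")
  case True
  then show ?thesis using assms by (intro heavy_pair_aux) auto
next
  case False
  have "e * v * u \<le> 27 * sqrt d * (b * v\<^sup>2) * (a * u\<^sup>2)
    + heavy_bound n d r b v u + heavy_bound n d r a u v"
    using False assms by (intro heavy_pair_aux) (auto simp: mult_ac)
  then show ?thesis by (simp add: mult_ac)
qed

section \<open>Summation over the dyadic levels\<close>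

lemma geometric_sum_le:
  fixes c X :: real
  assumes "c > 0" "X \<ge> 0"
  shows "(\<Sum>s\<le>m. if c * 2 ^ s \<le> X then c * 2 ^ s else 0) \<le> 2 * X"
proof (induction m)
  case 0
  show ?case using assms by (cases "c \<le> X") simp_all
next
  case (Suc m)
  show ?case
  proof (cases "c * 2 ^ Suc m \<le> X")
    case True
    have "(\<Sum>s\<le>Suc m. if c * 2 ^ s \<le> X then c * 2 ^ s else 0) \<le> (\<Sum>s\<le>Suc m. c * 2 ^ s)"
      using assms by (intro sum_mono) auto
    also have "\<dots> = c * 2 ^ Suc (Suc m) - c"
      by (induction m) (auto simp: algebra_simps)
    finally show ?thesis using True assms by simp
  next
    case False
    then show ?thesis using Suc by simp
  qed
qed

text \<open>The smallest admissible \<open>c * 2 ^ s\<close> dominates, so the induction removes the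
  term \<open>s = 0\<close> and doubles \<open>c\<close>; hence \<open>c\<close> is kept
  arbitrary.\<close>

lemma geometric_sum_inverse_le:
  fixes c X :: real
  assumes "c > 0" "X > 0"
  shows "(\<Sum>s\<le>m. if X \<le> c * 2 ^ s then 1 / (c * 2 ^ s) else 0) \<le> 2 / X"
  using assms(1)
proof (induction m arbitrary: c)
  case 0
  have "1 / c \<le> 2 / X" if "X \<le> c"
    using that assms 0 by (intro frac_le) auto
  then show ?case using assms by (cases "X \<le> c") simp_all
next
  case (Suc m)
  show ?case
  proof (cases "X \<le> c")
    case True
    have "(\<Sum>s\<le>Suc m. if X \<le> c * 2 ^ s then 1 / (c * 2 ^ s) else 0) \<le> (\<Sum>s\<le>Suc m. 1 / c * (1 / 2) ^ s)"
      using Suc.prems by (intro sum_mono) (auto simp: power_divide)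
    also have "\<dots> = 1 / c * (2 - (1 / 2) ^ Suc m)"
      by (induction m) (auto simp: algebra_simps)
    also have "\<dots> \<le> 1 / c * 2" using Suc.prems by (intro mult_left_mono) auto
    also have "\<dots> \<le> 2 / X" using True assms Suc.prems by (simp add: frac_le)
    finally show ?thesis .
  next
    case False
    have "c * 2 ^ Suc s = (2 * c) * 2 ^ s" for s by simp
    then have "(\<Sum>s\<le>Suc m. if X \<le> c * 2 ^ s then 1 / (c * 2 ^ s) else 0) =
        (\<Sum>s\<le>m. if X \<le> (2 * c) * 2 ^ s then 1 / ((2 * c) * 2 ^ s) else 0)"
      using False by (subst sum.atMost_Suc_shift) (simp only: power_0 mult_1_right if_False add_0)
    also have "\<dots> \<le> 2 / X" using Suc.prems by (intro Suc.IH) auto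
    finally show ?thesis .
  qed
qed

definition levels :: "nat \<Rightarrow> real set" where
  "levels n = level n ` {..n + 2}"

lemma sum_levels: "n \<ge> 1 \<Longrightarrow> (\<Sum>v\<in>levels n. f v) = (\<Sum>s\<le>n+2. f (1 / (4 * sqrt n) * 2 ^ s))"
  unfolding levels_def by (subst sum.reindex) (auto simp: inj_on_def level_def)

text \<open>Each progression sums to at most twice its value at the cut-off, where it is of order
  \<open>sqrt d * (a * u^2)\<close>. The constant is \<open>16 + 56 + 112 + 8\<close>, the last
  summand being multiplied by \<open>r \<ge> 1\<close>.\<close>

lemma sum_heavy_bound:
  assumes n: "n \<ge> 1" and d: "d \<ge> 1" and r: "r \<ge> 1" and a: "a \<ge> 0" and u: "u > 0"
  shows "(\<Sum>v\<in>levels n. heavy_bound n d r a u v) \<le> 192 * r * sqrt d * (a * u\<^sup>2)"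
proof -
  have n0: "real n > 0" and sd: "sqrt d > 0" "sqrt d * sqrt d = d" using n d by auto
  have c: "1 / (4 * sqrt n) > 0" using n by simp
  have S1: "(\<Sum>v\<in>levels n. if v \<le> X then v else 0) \<le> 2 * X" if "X \<ge> 0" for X
    unfolding sum_levels[OF n] by (rule geometric_sum_le[OF c that])
  have S2: "(\<Sum>v\<in>levels n. if X \<le> v then 1 / v else 0) \<le> 2 / X" if "X > 0" for X
    unfolding sum_levels[OF n] by (rule geometric_sum_inverse_le[OF c that])
  have "(\<Sum>v\<in>levels n. heavy_bound n d r a u v) =
      8 * r * d * a * u * (\<Sum>v\<in>levels n. if v \<le> u / sqrt d then v else 0) +
      28 * r * a * u * (\<Sum>v\<in>levels n. if v \<le> sqrt d * u then v else 0) +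
      28 * r * sqrt n * a * u\<^sup>2 * (\<Sum>v\<in>levels n. if v \<le> 2 * sqrt d / sqrt n then v else 0) +
      4 * (d / n) * a * u * (\<Sum>v\<in>levels n. if sqrt d / n / u \<le> v then 1 / v else 0)"
    unfolding heavy_bound_def sum.distrib sum_distrib_left
    using sd by (intro arg_cong2[where f = "(+)"] sum.cong) (auto simp: field_simps)
  also have "\<dots> \<le> 8 * r * d * a * u * (2 * (u / sqrt d)) + 28 * r * a * u * (2 * (sqrt d * u)) +
      28 * r * sqrt n * a * u\<^sup>2 * (2 * (2 * sqrt d / sqrt n)) + 4 * (d / n) * a * u * (2 / (sqrt d / n / u))"
    using n0 sd d r a u by (intro add_mono mult_left_mono S1 S2) auto
  also have "\<dots> = (16 * r + 56 * r + 112 * r + 8) * (sqrt d * (a * u\<^sup>2))"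
  proof -
    have "d / sqrt d = sqrt d" using sd by (simp add: field_simps)
    then have "8 * r * d * a * u * (2 * (u / sqrt d)) = 16 * r * (sqrt d * (a * u\<^sup>2))"
      "4 * (d / n) * a * u * (2 / (sqrt d / n / u)) = 8 * (sqrt d * (a * u\<^sup>2))"
      using n0 u by (simp_all add: power2_eq_square) (metis times_divide_eq_right mult.assoc mult.commute)+
    moreover have "28 * r * a * u * (2 * (sqrt d * u)) = 56 * r * (sqrt d * (a * u\<^sup>2))"
      by (simp add: power2_eq_square)
    moreover have "28 * r * sqrt n * a * u\<^sup>2 * (2 * (2 * sqrt d / sqrt n)) = 112 * r * (sqrt d * (a * u\<^sup>2))"
      using n0 by (simp add: field_simps)
    ultimately show ?thesis by (simp only: distrib_right)
  qed
  also have "\<dots> \<le> (192 * r) * (sqrt d * (a * u\<^sup>2))"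
    using r d a by (intro mult_right_mono) auto
  finally show ?thesis by (simp add: mult_ac)
qed

lemma dyadic_net_abs_level:
  assumes "x \<in> dyadic_net n" "i \<in> {1..n}" "x i \<noteq> 0"
  shows "\<bar>x i\<bar> \<in> levels n"
proof -
  have "x i \<in> net_values n" using assms by (auto simp: dyadic_net_def)
  moreover have "0 \<le> level n s" for s by (simp add: level_def)
  ultimately show ?thesis using assms(3) by (auto simp: net_values_def levels_def abs_of_nonneg)
qed

lemma sum_level_mass:
  assumes x: "x \<in> dyadic_net n" and S: "S \<subseteq> {1..n}"
  shows "(\<Sum>u\<in>levels n. real (card {i\<in>S. \<bar>x i\<bar> = u}) * u\<^sup>2) \<le> 1"
proof -
  have fin: "finite S" using S finite_subset by blast
  have "(\<Sum>u\<in>levels n. real (card {i\<in>S. \<bar>x i\<bar> = u}) * u\<^sup>2) =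
      (\<Sum>u\<in>levels n. \<Sum>i\<in>{i \<in> {i\<in>S. \<bar>x i\<bar> \<in> levels n}. \<bar>x i\<bar> = u}. (x i)\<^sup>2)"
  proof (intro sum.cong refl)
    fix u assume u: "u \<in> levels n"
    have "(\<Sum>i\<in>{i \<in> {i\<in>S. \<bar>x i\<bar> \<in> levels n}. \<bar>x i\<bar> = u}. (x i)\<^sup>2) = (\<Sum>i\<in>{i\<in>S. \<bar>x i\<bar> = u}. u\<^sup>2)"
      using u by (intro sum.cong) auto
    then show "real (card {i\<in>S. \<bar>x i\<bar> = u}) * u\<^sup>2 =
        (\<Sum>i\<in>{i \<in> {i\<in>S. \<bar>x i\<bar> \<in> levels n}. \<bar>x i\<bar> = u}. (x i)\<^sup>2)" by simp
  qed
  also have "\<dots> = (\<Sum>i\<in>{i\<in>S. \<bar>x i\<bar> \<in> levels n}. (x i)\<^sup>2)"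
    using fin by (intro sum.group) (auto simp: levels_def)
  also have "\<dots> \<le> (\<Sum>i=1..n. (x i)\<^sup>2)" using S by (intro sum_mono2) auto
  also have "\<dots> \<le> 1" using x by (simp add: dyadic_net_def)
  finally show ?thesis .
qed

lemma discrepancyD:
  assumes "discrepancy n d r A" "I \<subseteq> {1..n}" "J \<subseteq> {1..n}" "I \<noteq> {}" "J \<noteq> {}"
    and "exp 1 * (real (card I) * real (card J) * d / n) < sum A (I \<times> J)"
  shows "sum A (I \<times> J) * ln (sum A (I \<times> J) / (exp 1 * (real (card I) * real (card J) * d / n)))
       \<le> 7 * r * entropy n (max (real (card I)) (real (card J)))"
  using assms unfolding discrepancy_def by blast

lemma sum_mass_le:
  assumes fin: "finite (levels n)" and "u \<in> levels n"
    and "(\<Sum>u\<in>levels n. real (c u) * (u::real)\<^sup>2) \<le> 1"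
  shows "real (c u) * u\<^sup>2 \<le> 1"
proof -
  have "real (c u) * u\<^sup>2 \<le> (\<Sum>u\<in>levels n. real (c u) * u\<^sup>2)"
    using assms by (intro member_le_sum[of u "levels n" "\<lambda>u. real (c u) * u\<^sup>2"]) auto
  then show ?thesis using assms by linarith
qed

text \<open>Heaviness depends only on the pair of levels, so the heavy pairs split into rectangles
  \<open>I u \<times> J v\<close>, each covered by \<open>heavy_pair\<close>. The constant is
  \<open>27 + 192 + 192\<close>: the product of the masses and one family of progressions per
  direction.\<close>

lemma sum_heavy_le:
  assumes n: "n \<ge> 1" and d: "d \<ge> 1" and r: "r \<ge> 1"
    and x: "x \<in> dyadic_net n" and y: "y \<in> dyadic_net n"
    and A: "\<And>e. A e \<in> {0, 1::real}"
    and S: "S \<subseteq> {1..n}" and S': "S' \<subseteq> {1..n}"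
    and rows: "\<And>i. i \<in> S \<Longrightarrow> (\<Sum>j=1..n. A (i, j)) \<le> 8 * r * d"
    and cols: "\<And>j. j \<in> S' \<Longrightarrow> (\<Sum>i=1..n. A (i, j)) \<le> 8 * r * d"
    and disc: "discrepancy n d r A"
  shows "(\<Sum>(i, j)\<in>{(i, j)\<in>S \<times> S'. sqrt d / n < \<bar>x i * y j\<bar>}. \<bar>x i * y j\<bar> * A (i, j)) \<le> 411 * r * sqrt d"
proof -
  let ?V = "levels n"
  define H where "H = {(i, j)\<in>S \<times> S'. sqrt d / n < \<bar>x i * y j\<bar>}"
  define f where "f = (\<lambda>(i, j). \<bar>x i * y j\<bar> * A (i, j))"
  define g where "g = (\<lambda>(i, j). (\<bar>x i\<bar>, \<bar>y j\<bar>))"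
  define I where "I u = {i\<in>S. \<bar>x i\<bar> = u}" for u :: real
  define J where "J v = {j\<in>S'. \<bar>y j\<bar> = v}" for v :: real
  define a where "a u = card (I u)" for u :: real
  define b where "b v = card (J v)" for v :: real
  define T where "T u v = 27 * sqrt d * (a u * u\<^sup>2) * (b v * v\<^sup>2)
    + heavy_bound n d r (a u) u v + heavy_bound n d r (b v) v u" for u v :: real
  have A0: "A e \<ge> 0" for e using A[of e] by auto
  have A1: "A e \<le> 1" for e using A[of e] by auto
  have finS: "finite S" "finite S'" using S S' finite_subset by blast+
  have finH: "finite H" unfolding H_def by (rule finite_subset[of _ "S \<times> S'"]) (use finS in auto)
  have finV: "finite ?V" by (simp add: levels_def)
  have Vpos: "u > 0" if "u \<in> ?V" for u using that level_pos[OF n] by (auto simp: levels_def)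
  have a_sum: "(\<Sum>u\<in>?V. a u * u\<^sup>2) \<le> 1" unfolding a_def I_def using x S by (rule sum_level_mass)
  have b_sum: "(\<Sum>v\<in>?V. b v * v\<^sup>2) \<le> 1" unfolding b_def J_def using y S' by (rule sum_level_mass)
  have gH: "g ` H \<subseteq> ?V \<times> ?V"
  proof clarsimp
    fix u v i j assume h: "(i, j) \<in> H" "(u, v) = g (i, j)"
    have "sqrt d / n \<ge> 0" using d by simp
    then have "x i \<noteq> 0" "y j \<noteq> 0" using h by (auto simp: H_def)
    then show "u \<in> ?V \<and> v \<in> ?V"
      using h dyadic_net_abs_level[OF x, of i] dyadic_net_abs_level[OF y, of j] S S'
      by (auto simp: H_def g_def)
  qed
  have block: "(\<Sum>e\<in>{e\<in>H. g e = (u, v)}. f e) \<le> T u v" if uv: "u \<in> ?V" "v \<in> ?V" for u v :: real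
  proof (cases "{e\<in>H. g e = (u, v)} = {}")
    case True
    have "0 \<le> T u v" unfolding T_def using Vpos[OF uv(1)] Vpos[OF uv(2)] r d
      by (intro add_nonneg_nonneg heavy_bound_ge(1)) auto
    then show ?thesis unfolding True by simp
  next
    case False
    then obtain i j where ij: "(i, j) \<in> H" "g (i, j) = (u, v)" by auto
    then have ne: "i \<in> I u" "j \<in> J v" and heavy: "sqrt d / n < u * v"
      by (auto simp: H_def g_def I_def J_def abs_mult)
    have fin: "finite (I u)" "finite (J v)" using finS by (auto simp: I_def J_def)
    have sub: "I u \<subseteq> {1..n}" "J v \<subseteq> {1..n}" using S S' by (auto simp: I_def J_def)
    have ab: "a u > 0" "b v > 0" using fin ne by (auto simp: a_def b_def card_gt_0_iff)
    have abn: "a u \<le> n" "b v \<le> n"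
      using card_mono[OF _ sub(1)] card_mono[OF _ sub(2)] by (auto simp: a_def b_def)
    define e where "e = sum A (I u \<times> J v)"
    have e0: "e \<ge> 0" unfolding e_def using A0 by (intro sum_nonneg) auto
    have "e = (\<Sum>i\<in>I u. \<Sum>j\<in>J v. A (i, j))" unfolding e_def by (simp add: sum.cartesian_product)
    also have "\<dots> \<le> (\<Sum>i\<in>I u. \<Sum>j=1..n. A (i, j))"
      using sub A0 by (intro sum_mono sum_mono2) auto
    also have "\<dots> \<le> (\<Sum>i\<in>I u. 8 * r * d)" using rows by (intro sum_mono) (auto simp: I_def)
    finally have ea: "e \<le> 8 * r * d * a u" by (simp add: a_def mult_ac)
    have "e = (\<Sum>j\<in>J v. \<Sum>i\<in>I u. A (i, j))"
      unfolding e_def by (subst sum.swap) (simp add: sum.cartesian_product)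
    also have "\<dots> \<le> (\<Sum>j\<in>J v. \<Sum>i=1..n. A (i, j))"
      using sub A0 by (intro sum_mono sum_mono2) auto
    also have "\<dots> \<le> (\<Sum>j\<in>J v. 8 * r * d)" using cols by (intro sum_mono) (auto simp: J_def)
    finally have eb: "e \<le> 8 * r * d * b v" by (simp add: b_def mult_ac)
    have dis: "e * ln (e / (exp 1 * (real (a u) * real (b v) * d / n))) \<le> 7 * r * entropy n (max (real (a u)) (real (b v)))"
      if "exp 1 * (real (a u) * real (b v) * d / n) < e"
      using discrepancyD[OF disc sub] ne that unfolding e_def a_def b_def by blast
    have "(\<Sum>e\<in>{e\<in>H. g e = (u, v)}. f e) = (\<Sum>e\<in>{e\<in>H. g e = (u, v)}. A e * (u * v))"
      by (intro sum.cong) (auto simp: f_def g_def abs_mult)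
    also have "\<dots> \<le> (\<Sum>e\<in>I u \<times> J v. A e * (u * v))"
      using fin A0 Vpos[OF uv(1)] Vpos[OF uv(2)]
      by (intro sum_mono2) (auto simp: H_def g_def I_def J_def)
    also have "\<dots> = e * u * v" by (simp add: e_def sum_distrib_right mult.assoc)
    also have "\<dots> \<le> T u v" unfolding T_def
    proof (rule heavy_pair[OF n d r])
      show "real (a u) * u\<^sup>2 \<le> 1" by (rule sum_mass_le[OF finV uv(1) a_sum])
      show "real (b v) * v\<^sup>2 \<le> 1" by (rule sum_mass_le[OF finV uv(2) b_sum])
    qed (use dis ab abn Vpos[OF uv(1)] Vpos[OF uv(2)] heavy e0 ea eb in simp_all)
    finally show ?thesis .
  qed
  have "sum f H = (\<Sum>w\<in>?V \<times> ?V. \<Sum>e\<in>{e\<in>H. g e = w}. f e)"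
    using finH finV gH by (intro sum.group[symmetric]) auto
  also have "\<dots> \<le> (\<Sum>(u, v)\<in>?V \<times> ?V. T u v)"
    using block by (intro sum_mono) auto
  also have "\<dots> = (\<Sum>u\<in>?V. \<Sum>v\<in>?V. T u v)" by (simp add: sum.cartesian_product)
  also have "\<dots> = 27 * sqrt d * ((\<Sum>u\<in>?V. a u * u\<^sup>2) * (\<Sum>v\<in>?V. b v * v\<^sup>2))
      + (\<Sum>u\<in>?V. \<Sum>v\<in>?V. heavy_bound n d r (a u) u v) + (\<Sum>u\<in>?V. \<Sum>v\<in>?V. heavy_bound n d r (b v) v u)"
  proof -
    have "27 * sqrt d * ((\<Sum>u\<in>?V. a u * u\<^sup>2) * (\<Sum>v\<in>?V. b v * v\<^sup>2)) =
        (\<Sum>u\<in>?V. \<Sum>v\<in>?V. 27 * sqrt d * (a u * u\<^sup>2) * (b v * v\<^sup>2))"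
      by (subst sum_product) (simp add: sum_distrib_left mult.assoc)
    then show ?thesis by (simp only: T_def sum.distrib)
  qed
  \<comment> \<open>These progressions run in \<open>u\<close>, the level of the rows, so the inner
    sum has to be the one over \<open>u\<close>.\<close>
  also have "(\<Sum>u\<in>?V. \<Sum>v\<in>?V. heavy_bound n d r (b v) v u) = (\<Sum>v\<in>?V. \<Sum>u\<in>?V. heavy_bound n d r (b v) v u)"
    by (rule sum.swap)
  also have "27 * sqrt d * ((\<Sum>u\<in>?V. a u * u\<^sup>2) * (\<Sum>v\<in>?V. b v * v\<^sup>2))
      + (\<Sum>u\<in>?V. \<Sum>v\<in>?V. heavy_bound n d r (a u) u v) + (\<Sum>v\<in>?V. \<Sum>u\<in>?V. heavy_bound n d r (b v) v u)
      \<le> 27 * sqrt d * (1 * 1) + (\<Sum>u\<in>?V. 192 * r * sqrt d * (a u * u\<^sup>2)) + (\<Sum>v\<in>?V. 192 * r * sqrt d * (b v * v\<^sup>2))"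
    using n d r Vpos a_sum b_sum
    by (intro add_mono mult_left_mono mult_mono sum_mono sum_heavy_bound) (auto intro: sum_nonneg)
  also have "\<dots> = 27 * sqrt d + 192 * r * sqrt d * (\<Sum>u\<in>?V. a u * u\<^sup>2) + 192 * r * sqrt d * (\<Sum>v\<in>?V. b v * v\<^sup>2)"
    by (simp add: sum_distrib_left)
  also have "\<dots> \<le> 27 * (r * sqrt d) + 192 * r * sqrt d * 1 + 192 * r * sqrt d * 1"
    using a_sum b_sum r d by (intro add_mono mult_left_mono) auto
  finally show ?thesis by (simp add: H_def f_def)
qed

subsection \<open>Splitting sparse edge sets\<close>

lemma discrepancy_swap:
  assumes "discrepancy n d r A"
  shows "discrepancy n d r (\<lambda>(i, j). A (j, i))"
  unfolding discrepancy_def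
proof (intro allI impI)
  fix I J assume IJ: "I \<subseteq> {1..n}" "J \<subseteq> {1..n}" "I \<noteq> {}" "J \<noteq> {}"
  have eq: "sum (\<lambda>(i, j). A (j, i)) (I \<times> J) = sum A (J \<times> I)"
  proof -
    have "sum (\<lambda>(i, j). A (j, i)) (I \<times> J) = (\<Sum>i\<in>I. \<Sum>j\<in>J. A (j, i))"
      by (simp add: sum.cartesian_product)
    also have "\<dots> = (\<Sum>j\<in>J. \<Sum>i\<in>I. A (j, i))" by (rule sum.swap)
    also have "\<dots> = sum A (J \<times> I)" by (simp add: sum.cartesian_product)
    finally show ?thesis .
  qed
  assume "exp 1 * (real (card I) * real (card J) * d / n) < sum (\<lambda>(i, j). A (j, i)) (I \<times> J)"
  then show "sum (\<lambda>(i, j). A (j, i)) (I \<times> J) *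
      ln (sum (\<lambda>(i, j). A (j, i)) (I \<times> J) / (exp 1 * (real (card I) * real (card J) * d / n)))
    \<le> 7 * r * entropy n (max (real (card I)) (real (card J)))"
    unfolding eq using discrepancyD[OF assms IJ(2,1,4,3)]
    by (simp only: mult.commute[of "real (card J)"] max.commute[of "real (card J)"])
qed

text \<open>With \<open>m\<close> the shorter and \<open>M\<close> the longer side, the mean is at
  most \<open>M * q\<close> for \<open>q = m * d / n\<close>, and \<open>small\<close> gives
  \<open>q^2 \<le> M / n\<close>. More than \<open>32 * r * M\<close> ones would make the excess
  ratio \<open>l\<close> at least \<open>10 / q\<close>, so \<open>l^2 \<ge> e * n / M\<close> and
  \<open>ln l\<close> is at least half of \<open>1 + ln (n / M)\<close>. The discrepancy property
  would then require \<open>16 * r * entropy n M \<le> 7 * r * entropy n M\<close>.\<close>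

lemma sparse_block:
  assumes n: "n \<ge> 1" and d: "d > 0" and r: "r \<ge> 1" and disc: "discrepancy n d r A"
    and IJ: "I \<subseteq> {1..n}" "J \<subseteq> {1..n}" "I \<noteq> {}" "J \<noteq> {}"
    and small: "min (real (card I)) (real (card J)) * d\<^sup>2 \<le> n"
  shows "sum A (I \<times> J) \<le> 32 * r * max (real (card I)) (real (card J))"
proof (rule ccontr)
  define M where "M = max (real (card I)) (real (card J))"
  define m where "m = min (real (card I)) (real (card J))"
  define e where "e = sum A (I \<times> J)"
  define q where "q = m * d / n"
  assume "\<not> ?thesis"
  then have big: "e > 32 * r * M" by (simp add: e_def M_def)
  have n0: "real n > 0" using n by simp
  have "finite I" "finite J" using IJ finite_subset by blast+
  then have pos: "card I > 0" "card J > 0" using IJ by (auto simp: card_gt_0_iff)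
  have "card I \<le> n" "card J \<le> n" using card_mono[OF _ IJ(1)] card_mono[OF _ IJ(2)] by auto
  then have Mm: "m > 0" "m \<le> M" "M \<le> n" using pos by (auto simp: M_def m_def)
  have q: "q > 0" using Mm d n0 by (simp add: q_def)
  have "q\<^sup>2 = m * (m * d\<^sup>2) / n\<^sup>2" by (simp add: q_def power2_eq_square)
  also have "\<dots> \<le> m * n / n\<^sup>2"
    using small Mm unfolding m_def[symmetric] by (intro divide_right_mono mult_left_mono) auto
  also have "\<dots> = m / n" using n0 by (simp add: power2_eq_square)
  also have "\<dots> \<le> M / n" using Mm n0 by (intro divide_right_mono) auto
  finally have q2: "q\<^sup>2 \<le> M / n" .
  also have "\<dots> \<le> 1" using Mm n0 by simp
  finally have q1: "q \<le> 1" using q by (simp only: abs_square_le_1 abs_of_pos)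
  have "real (card I) * real (card J) = M * m" by (simp add: M_def m_def max_def min_def)
  then have \<mu>: "real (card I) * real (card J) * d / n = M * q" by (simp add: q_def)
  have "exp 1 * (M * q) \<le> 3 * (M * 1)"
    using exp_1_le_3 Mm q q1 by (intro mult_mono) auto
  also have "\<dots> \<le> 32 * r * M" using r Mm by (simp add: mult_right_mono)
  also have "\<dots> < e" by (rule big)
  finally have "exp 1 * (M * q) < e" .
  then have dis: "e * ln (e / (exp 1 * (M * q))) \<le> 7 * r * entropy n M"
    using discrepancyD[OF disc IJ] unfolding \<mu> e_def M_def by blast
  define l where "l = e / (exp 1 * (M * q))"
  have "10 * q * (exp 1 * M) \<le> 10 * q * (3 * M)"
    using exp_1_le_3 Mm q by (intro mult_mono) auto
  also have "\<dots> \<le> 32 * r * M * q" using r Mm q by (simp add: mult_right_mono)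
  also have "\<dots> \<le> e * q" using big q by simp
  finally have "10 * q * (exp 1 * M) \<le> e * q" .
  then have "10 \<le> e / (exp 1 * M)" using Mm q by (simp add: field_simps)
  then have "10 / q \<le> l" using q Mm by (simp add: l_def field_simps)
  then have "(10 / q)\<^sup>2 \<le> l\<^sup>2" using q by (intro power_mono) auto
  moreover have "exp 1 * (n / M) \<le> (10 / q)\<^sup>2"
  proof -
    have "exp 1 * (n / M) \<le> 100 * (n / M)" using exp_1_le_3 Mm by (intro mult_right_mono) auto
    also have "\<dots> = 100 / (M / n)" by simp
    also have "\<dots> \<le> 100 / q\<^sup>2" using q2 q Mm n0 by (intro divide_left_mono) auto
    finally show ?thesis by (simp add: power_divide)
  qed
  ultimately have "exp 1 * (n / M) \<le> l\<^sup>2" by linarith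
  then have "ln (exp 1 * (n / M)) \<le> ln (l\<^sup>2)" using Mm n0 by (intro ln_mono) auto
  moreover have "l > 0" using \<open>10 / q \<le> l\<close> q by (smt (verit) divide_pos_pos)
  moreover have "ln (exp 1 * (n / M)) = 1 + ln (n / M)" using Mm n0 by (subst ln_mult) auto
  ultimately have lnl: "1 + ln (n / M) \<le> 2 * ln l" by (simp only: ln_realpow of_nat_numeral)
  have "ln (n / M) \<ge> 0" using Mm n0 by simp
  then have ent: "entropy n M > 0" using Mm by (simp add: entropy_def add_pos_nonneg)
  have "16 * r * entropy n M = 32 * r * M * ((1 + ln (n / M)) / 2)" by (simp add: entropy_def)
  also have "\<dots> \<le> e * ln l"
  proof (rule mult_mono)
    have "0 \<le> 32 * r * M" using r Mm by simp
    then show "0 \<le> e" using big by linarith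
  qed (use big lnl \<open>ln (n / M) \<ge> 0\<close> in auto)
  also have "\<dots> \<le> 7 * r * entropy n M" using dis by (simp add: l_def)
  finally show False using ent r by simp
qed

text \<open>A light row is moved to \<open>R\<close> as a whole. The rest contains no further entry
  of that row, so its count in \<open>R\<close> is final; columns and \<open>C\<close> are treated
  alike. The hypothesis speaks of all subsets and is therefore inherited by the rest.\<close>

lemma peel:
  fixes E :: "('a \<times> 'b) set" and D :: real
  assumes "finite E" and D: "D \<ge> 0"
    and "\<And>F. F \<subseteq> E \<Longrightarrow> F \<noteq> {} \<Longrightarrow>
      (\<exists>i\<in>fst ` F. card {j. (i, j) \<in> F} \<le> D) \<or> (\<exists>j\<in>snd ` F. card {i. (i, j) \<in> F} \<le> D)"
  obtains R C where "R \<union> C = E" "R \<inter> C = {}"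
    "\<And>i. card {j. (i, j) \<in> R} \<le> D" "\<And>j. card {i. (i, j) \<in> C} \<le> D"
proof -
  have "\<exists>R C. R \<union> C = E \<and> R \<inter> C = {} \<and> (\<forall>i. card {j. (i, j) \<in> R} \<le> D) \<and> (\<forall>j. card {i. (i, j) \<in> C} \<le> D)"
    using assms(1,3)
  proof (induction E rule: finite_psubset_induct)
    case (psubset E)
    show ?case
    proof (cases "E = {}")
      case True
      then show ?thesis using D by (intro exI[of _ "{}"]) auto
    next
      case False
      then consider (row) i where "i \<in> fst ` E" "card {j. (i, j) \<in> E} \<le> D"
        | (col) j where "j \<in> snd ` E" "card {i. (i, j) \<in> E} \<le> D"
        using psubset.prems[of E] by auto
      then show ?thesis
      proof cases
        case row
        define X where "X = {e\<in>E. fst e = i}"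
        have "E - X \<subset> E" using row(1) by (auto simp: X_def)
        then have "\<exists>R C. R \<union> C = E - X \<and> R \<inter> C = {} \<and>
            (\<forall>i. card {j. (i, j) \<in> R} \<le> D) \<and> (\<forall>j. card {i. (i, j) \<in> C} \<le> D)"
          by (rule psubset.IH) (rule psubset.prems, auto)
        then obtain R C where RC: "R \<union> C = E - X" "R \<inter> C = {}"
          "\<And>i. card {j. (i, j) \<in> R} \<le> D" "\<And>j. card {i. (i, j) \<in> C} \<le> D"
          by blast
        have "card {j. (k, j) \<in> R \<union> X} \<le> D" for k
        proof (cases "k = i")
          case True
          have "{j. (k, j) \<in> R \<union> X} = {j. (i, j) \<in> E}" using RC(1) True by (auto simp: X_def)
          then show ?thesis using row(2) by simp
        next
          case False
          then have "{j. (k, j) \<in> R \<union> X} = {j. (k, j) \<in> R}" by (auto simp: X_def)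
          then show ?thesis using RC(3) by simp
        qed
        then show ?thesis using RC by (intro exI[of _ "R \<union> X"] exI[of _ C]) (auto simp: X_def)
      next
        case col
        define X where "X = {e\<in>E. snd e = j}"
        have "E - X \<subset> E" using col(1) by (auto simp: X_def)
        then have "\<exists>R C. R \<union> C = E - X \<and> R \<inter> C = {} \<and>
            (\<forall>i. card {j. (i, j) \<in> R} \<le> D) \<and> (\<forall>j. card {i. (i, j) \<in> C} \<le> D)"
          by (rule psubset.IH) (rule psubset.prems, auto)
        then obtain R C where RC: "R \<union> C = E - X" "R \<inter> C = {}"
          "\<And>i. card {j. (i, j) \<in> R} \<le> D" "\<And>j. card {i. (i, j) \<in> C} \<le> D"
          by blast
        have "card {i. (i, k) \<in> C \<union> X} \<le> D" for k
        proof (cases "k = j")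
          case True
          have "{i. (i, k) \<in> C \<union> X} = {i. (i, j) \<in> E}" using RC(1) True by (auto simp: X_def)
          then show ?thesis using col(2) by simp
        next
          case False
          then have "{i. (i, k) \<in> C \<union> X} = {i. (i, k) \<in> C}" by (auto simp: X_def)
          then show ?thesis using RC(4) by simp
        qed
        then show ?thesis using RC by (intro exI[of _ R] exI[of _ "C \<union> X"]) (auto simp: X_def)
      qed
    qed
  qed
  then show ?thesis using that by blast
qed

lemma card_gt_rows:
  fixes F :: "('a \<times> 'b) set" and D :: real
  assumes fin: "finite F" and ne: "F \<noteq> {}" and rows: "\<And>i. i \<in> fst ` F \<Longrightarrow> D < card {j. (i, j) \<in> F}"
  shows "D * card (fst ` F) < card F"
proof -
  have F: "F = Sigma (fst ` F) (\<lambda>i. {j. (i, j) \<in> F})" by force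
  have "finite {j. (i, j) \<in> F}" for i
    by (rule finite_subset[of _ "snd ` F"]) (use fin in force)+
  then have "card F = (\<Sum>i\<in>fst ` F. card {j. (i, j) \<in> F})"
    by (subst F) (use fin in \<open>simp add: card_SigmaI\<close>)
  moreover have "(\<Sum>i\<in>fst ` F. D) < (\<Sum>i\<in>fst ` F. real (card {j. (i, j) \<in> F}))"
    using fin ne rows by (intro sum_strict_mono) auto
  ultimately show ?thesis by (simp add: mult.commute)
qed

lemma card_gt_cols:
  fixes F :: "('a \<times> 'b) set" and D :: real
  assumes fin: "finite F" and ne: "F \<noteq> {}" and cols: "\<And>j. j \<in> snd ` F \<Longrightarrow> D < card {i. (i, j) \<in> F}"
  shows "D * card (snd ` F) < card F"
proof -
  have "fst ` (F\<inverse>) = snd ` F" by force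
  moreover have "F\<inverse> \<noteq> {}" using ne by auto
  ultimately show ?thesis using card_gt_rows[of "F\<inverse>" D] fin cols by simp
qed

lemma card_ones_le_sum:
  assumes A: "\<And>e. A e \<in> {0, 1::real}" and F: "F \<subseteq> {e. A e = 1}" "F \<subseteq> S" and "finite S"
  shows "real (card F) \<le> sum A S"
proof -
  have "real (card F) = sum A F" using F by (simp add: subset_iff)
  also have "\<dots> \<le> sum A S"
    using assms by (intro sum_mono2) (metis insert_iff le_numeral_extra(3) singletonD zero_le_one)+
  finally show ?thesis .
qed

text \<open>If all rows and columns of some \<open>F\<close> had more than \<open>32 * r\<close>
  entries, then \<open>F\<close> would have more than \<open>32 * r\<close> times the longer side of
  \<open>fst\<close> F \<times> snd \<open>F\<close>, against \<open>sparse_block\<close>. That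
  lemma constrains only the shorter side, so a bound on the number of rows suffices.\<close>

lemma peel_core:
  fixes d r :: real
  assumes n: "n \<ge> 1" and d: "d > 0" and r: "r \<ge> 1" and disc: "discrepancy n d r A"
    and A: "\<And>e. A e \<in> {0, 1}" and E: "E \<subseteq> grid n" "E \<subseteq> {e. A e = 1}"
    and small: "card (fst ` E) * d\<^sup>2 \<le> n"
  obtains R C where "R \<union> C = E" "R \<inter> C = {}"
    "\<And>i. card {j. (i, j) \<in> R} \<le> 32 * r" "\<And>j. card {i. (i, j) \<in> C} \<le> 32 * r"
proof (rule peel[of E "32 * r"])
  show finE: "finite E" using E finite_subset finite_grid by blast
  show "0 \<le> 32 * r" using r by simp
  fix F assume F: "F \<subseteq> E" "F \<noteq> {}"
  have fin: "finite F" using finE F finite_subset by blast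
  show "(\<exists>i\<in>fst ` F. card {j. (i, j) \<in> F} \<le> 32 * r) \<or> (\<exists>j\<in>snd ` F. card {i. (i, j) \<in> F} \<le> 32 * r)"
  proof (rule ccontr)
    assume "\<not> ?thesis"
    then have no: "\<And>i. i \<in> fst ` F \<Longrightarrow> 32 * r < card {j. (i, j) \<in> F}"
      "\<And>j. j \<in> snd ` F \<Longrightarrow> 32 * r < card {i. (i, j) \<in> F}"
      by (meson not_le)+
    have *: "32 * r * card (fst ` F) < card F"
      by (rule card_gt_rows[OF fin F(2) no(1)])
    have **: "32 * r * card (snd ` F) < card F"
      by (rule card_gt_cols[OF fin F(2) no(2)])
    have FF: "F \<subseteq> fst ` F \<times> snd ` F" by force
    have "min (real (card (fst ` F))) (real (card (snd ` F))) * d\<^sup>2 \<le> card (fst ` E) * d\<^sup>2"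
    proof (intro mult_right_mono min.coboundedI1)
      show "real (card (fst ` F)) \<le> real (card (fst ` E))"
        using F finE by (simp add: card_mono image_mono)
    qed simp
    also note small
    finally have "sum A (fst ` F \<times> snd ` F) \<le> 32 * r * max (real (card (fst ` F))) (real (card (snd ` F)))"
      using n d r disc F E by (intro sparse_block) (auto simp: grid_def)
    moreover have "real (card F) \<le> sum A (fst ` F \<times> snd ` F)"
      using F E FF fin by (intro card_ones_le_sum A) auto
    ultimately show False using * ** by (auto simp: max_def split: if_splits)
  qed
next
  fix R C
  assume "R \<union> C = E" "R \<inter> C = {}"
    "\<And>i. card {j. (i, j) \<in> R} \<le> 32 * r" "\<And>j. card {i. (i, j) \<in> C} \<le> 32 * r"
  then show thesis by (rule that)
qed

text \<open>If \<open>J\<close> were larger than \<open>I\<close>, it would be the longer side of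
  \<open>I \<times> J\<close>, and more than \<open>32 * r * card J\<close> ones would contradict
  \<open>sparse_block\<close>.\<close>

lemma card_heavy_columns:
  fixes d r :: real
  assumes n: "n \<ge> 1" and d: "d > 0" and r: "r \<ge> 1" and disc: "discrepancy n d r A"
    and A: "\<And>e. A e \<in> {0, 1}" and I: "I \<subseteq> {1..n}" "card I * d\<^sup>2 \<le> n"
    and J: "J \<subseteq> {1..n}" "\<And>j. j \<in> J \<Longrightarrow> 32 * r < card {i\<in>I. A (i, j) = 1}"
  shows "card J \<le> card I"
proof (rule ccontr)
  assume less: "\<not> ?thesis"
  define F where "F = {(i, j). i \<in> I \<and> j \<in> J \<and> A (i, j) = 1}"
  have fin: "finite I" "finite J" using I J finite_subset by blast+
  have finF: "finite F" by (rule finite_subset[of _ "I \<times> J"]) (use fin in \<open>auto simp: F_def\<close>)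
  have row: "{i. (i, j) \<in> F} = {i\<in>I. A (i, j) = 1}" if "j \<in> J" for j using that by (auto simp: F_def)
  have ne: "{i\<in>I. A (i, j) = 1} \<noteq> {}" if "j \<in> J" for j
    using J(2)[OF that] r by (metis card.empty mult_nonneg_nonneg not_less of_nat_0 order.trans zero_le_numeral zero_le_one)
  have sndF: "snd ` F = J"
  proof
    show "J \<subseteq> snd ` F"
    proof
      fix j assume "j \<in> J"
      then obtain i where "(i, j) \<in> F" using ne[of j] by (auto simp: F_def)
      then show "j \<in> snd ` F" by force
    qed
  qed (auto simp: F_def)
  have "J \<noteq> {}" using less by auto
  then have "F \<noteq> {}" using sndF by auto
  then have "I \<noteq> {}" by (auto simp: F_def)
  have "32 * r * card J < card F"
    using card_gt_cols[OF finF \<open>F \<noteq> {}\<close>, of "32 * r"] J(2) row unfolding sndF by simp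
  also have "\<dots> \<le> sum A (I \<times> J)"
    using fin by (intro card_ones_le_sum A) (auto simp: F_def)
  also have "\<dots> \<le> 32 * r * max (real (card I)) (real (card J))"
    using less I(2) by (intro sparse_block[OF n d r disc I(1) J(1) \<open>I \<noteq> {}\<close> \<open>J \<noteq> {}\<close>]) (simp add: min_def)
  finally show False using less by (simp add: max_def split: if_splits)
qed

text \<open>Peeling all of \<open>E\<close> at once gives no control over the columns met by
  \<open>R\<close>, since discarded rows reach across the whole grid. So \<open>I\<close> and
  \<open>J\<close> are enlarged by the lines \<open>I'\<close>, \<open>J'\<close> that hold too many
  ones of the discarded part. A one in a row outside \<open>I \<union> I'\<close> lies in a column
  of \<open>J\<close> and goes to \<open>R\<close>; a one in a column outside
  \<open>J \<union> J'\<close> lies in a row of \<open>I\<close> and goes to \<open>C\<close>; only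
  the ones inside the enlarged block are peeled. Thus \<open>R\<close> stays within the columns
  \<open>J \<union> J'\<close>, and \<open>C\<close> within the rows
  \<open>I \<union> I'\<close>.\<close>

lemma edge_split:
  fixes d r :: real
  assumes n: "n \<ge> 1" and d: "d \<ge> 1" and r: "r \<ge> 1" and disc: "discrepancy n d r A"
    and A: "\<And>e. A e \<in> {0, 1}" and I: "I \<subseteq> {1..n}" "2 * real (card I) * d\<^sup>2 \<le> n"
    and J: "J \<subseteq> {1..n}" "2 * real (card J) * d\<^sup>2 \<le> n"
  obtains R C where "R \<union> C = {(i, j) \<in> grid n. A (i, j) = 1 \<and> (i \<in> I \<or> j \<in> J)}" "R \<inter> C = {}"
    "\<And>i. card {j. (i, j) \<in> R} \<le> 32 * r" "\<And>j. card {i. (i, j) \<in> C} \<le> 32 * r"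
    "card {j. \<exists>i. (i, j) \<in> R} \<le> n / d" "card {i. \<exists>j. (i, j) \<in> C} \<le> n / d"
proof -
  have d0: "d > 0" using d by simp
  define E where "E = {(i, j) \<in> grid n. A (i, j) = 1 \<and> (i \<in> I \<or> j \<in> J)}"
  define J' where "J' = {j\<in>{1..n} - J. 32 * r < card {i\<in>I. A (i, j) = 1}}"
  define I' where "I' = {i\<in>{1..n} - I. 32 * r < card {j\<in>J. A (i, j) = 1}}"
  have fin: "finite I" "finite J" using I J finite_subset by blast+
  have IJ2: "card I * d\<^sup>2 \<le> n" "card J * d\<^sup>2 \<le> n"
  proof -
    have "real (card I) * d\<^sup>2 \<ge> 0" "real (card J) * d\<^sup>2 \<ge> 0" by simp_all
    then show "card I * d\<^sup>2 \<le> n" "card J * d\<^sup>2 \<le> n" using I(2) J(2) by linarith+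
  qed
  have J': "card J' \<le> card I"
    by (rule card_heavy_columns[OF n d0 r disc A I(1) IJ2(1)]) (auto simp: J'_def)
  have "card I' \<le> card J"
    by (rule card_heavy_columns[OF n d0 r discrepancy_swap[OF disc] _ J(1) IJ2(2)]) (use A in \<open>auto simp: I'_def\<close>)
  have finI': "finite I'" "finite J'" by (auto simp: I'_def J'_def)
  \<comment> \<open>The cross bounds \<open>card I' \<le> card J\<close> and
    \<open>card J' \<le> card I\<close> reduce both sums to \<open>card I + card J\<close>; the
    factor 2 in the hypotheses is used up here.\<close>
  have cardII': "(real (card I) + real (card I')) * d\<^sup>2 \<le> n" "(real (card J) + real (card J')) * d\<^sup>2 \<le> n"
  proof -
    have "(real (card I) + real (card I')) * d\<^sup>2 \<le> (real (card I) + real (card J)) * d\<^sup>2"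
      using \<open>card I' \<le> card J\<close> by (intro mult_right_mono) auto
    moreover have "(real (card J) + real (card J')) * d\<^sup>2 \<le> (real (card I) + real (card J)) * d\<^sup>2"
      using J' by (intro mult_right_mono) auto
    moreover have "(real (card I) + real (card J)) * d\<^sup>2 \<le> n" using I(2) J(2) by (simp add: distrib_right)
    ultimately show "(real (card I) + real (card I')) * d\<^sup>2 \<le> n" "(real (card J) + real (card J')) * d\<^sup>2 \<le> n" by linarith+
  qed
  have cardnd: "real (card S) \<le> n / d" if "S \<subseteq> X \<union> Y" "finite X" "finite Y" "(real (card X) + real (card Y)) * d\<^sup>2 \<le> n"
    for S X Y :: "nat set"
  proof -
    have "card S \<le> card (X \<union> Y)" using that by (intro card_mono) auto
    also have "\<dots> \<le> card X + card Y" by (rule card_Un_le)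
    finally have "real (card S) * d \<le> (real (card X) + real (card Y)) * d" using d by (intro mult_right_mono) auto
    also have "\<dots> \<le> (real (card X) + real (card Y)) * d\<^sup>2"
      using d by (intro mult_left_mono) (auto simp: power2_eq_square)
    finally show ?thesis using that(4) d by (simp add: field_simps)
  qed
  define R0 where "R0 = {(i, j) \<in> E. i \<notin> I \<and> i \<notin> I'}"
  define C0 where "C0 = {(i, j) \<in> E. j \<notin> J \<and> j \<notin> J'}"
  define F where "F = E - R0 - C0"
  have F_sub: "F \<subseteq> (I \<union> I') \<times> (J \<union> J')" by (auto simp: F_def R0_def C0_def)
  have "card (fst ` F) \<le> card (I \<union> I')"
    using fin finI' F_sub by (intro card_mono) auto
  also have "\<dots> \<le> card I + card I'" by (rule card_Un_le)
  finally have "card (fst ` F) * d\<^sup>2 \<le> (real (card I) + real (card I')) * d\<^sup>2" by (intro mult_right_mono) auto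
  also note cardII'(1)
  finally have "card (fst ` F) * d\<^sup>2 \<le> n" .
  moreover have "F \<subseteq> grid n" "F \<subseteq> {e. A e = 1}" by (auto simp: F_def E_def)
  ultimately obtain R1 C1 where RC1: "R1 \<union> C1 = F" "R1 \<inter> C1 = {}"
    "\<And>i. card {j. (i, j) \<in> R1} \<le> 32 * r" "\<And>j. card {i. (i, j) \<in> C1} \<le> 32 * r"
    using peel_core[OF n d0 r disc A] by metis
  have R1: "(i, j) \<in> R1 \<Longrightarrow> i \<in> I \<union> I' \<and> j \<in> J \<union> J'" for i j using RC1(1) F_sub by auto
  have C1: "(i, j) \<in> C1 \<Longrightarrow> i \<in> I \<union> I' \<and> j \<in> J \<union> J'" for i j using RC1(1) F_sub by auto
  have R0: "(i, j) \<in> R0 \<Longrightarrow> i \<in> {1..n} \<and> i \<notin> I \<union> I' \<and> j \<in> J \<and> A (i, j) = 1" for i j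
    by (auto simp: R0_def E_def grid_def)
  have C0: "(i, j) \<in> C0 \<Longrightarrow> j \<in> {1..n} \<and> j \<notin> J \<union> J' \<and> i \<in> I \<and> A (i, j) = 1" for i j
    by (auto simp: C0_def E_def grid_def)
  \<comment> \<open>\<open>R0\<close> and \<open>R1\<close> share no row: rows of
    \<open>I \<union> I'\<close> are governed by the peeling, all others by the definition of
    \<open>I'\<close>.\<close>
  have rows: "card {j. (i, j) \<in> R0 \<union> R1} \<le> 32 * r" for i
  proof (cases "i \<in> I \<union> I' \<or> i \<notin> {1..n}")
    case True
    then have "{j. (i, j) \<in> R0 \<union> R1} = {j. (i, j) \<in> R1}" using R0 by blast
    then show ?thesis using RC1(3) by simp
  next
    case False
    then have "{j. (i, j) \<in> R0 \<union> R1} \<subseteq> {j\<in>J. A (i, j) = 1}" using R0 R1 by blast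
    then have "card {j. (i, j) \<in> R0 \<union> R1} \<le> card {j\<in>J. A (i, j) = 1}"
      using fin by (intro card_mono) auto
    moreover have "card {j\<in>J. A (i, j) = 1} \<le> 32 * r" using False by (auto simp: I'_def)
    ultimately show ?thesis by linarith
  qed
  have cols: "card {i. (i, j) \<in> C0 \<union> C1} \<le> 32 * r" for j
  proof (cases "j \<in> J \<union> J' \<or> j \<notin> {1..n}")
    case True
    then have "{i. (i, j) \<in> C0 \<union> C1} = {i. (i, j) \<in> C1}" using C0 by blast
    then show ?thesis using RC1(4) by simp
  next
    case False
    then have "{i. (i, j) \<in> C0 \<union> C1} \<subseteq> {i\<in>I. A (i, j) = 1}" using C0 C1 by blast
    then have "card {i. (i, j) \<in> C0 \<union> C1} \<le> card {i\<in>I. A (i, j) = 1}"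
      using fin by (intro card_mono) auto
    moreover have "card {i\<in>I. A (i, j) = 1} \<le> 32 * r" using False by (auto simp: J'_def)
    ultimately show ?thesis by linarith
  qed
  have union: "(R0 \<union> R1) \<union> (C0 \<union> C1) = E"
  proof -
    have "R0 \<subseteq> E" "C0 \<subseteq> E" by (auto simp: R0_def C0_def)
    then show ?thesis using RC1(1) by (auto simp: F_def)
  qed
  have disj: "(R0 \<union> R1) \<inter> (C0 \<union> C1) = {}"
  proof -
    have "R0 \<inter> C0 = {}" using R0 C0 by fastforce
    moreover have "R1 \<subseteq> F" "C1 \<subseteq> F" using RC1(1) by auto
    moreover have "F \<inter> R0 = {}" "F \<inter> C0 = {}" by (auto simp: F_def)
    ultimately show ?thesis using RC1(2) by blast
  qed
  have "{j. \<exists>i. (i, j) \<in> R0 \<union> R1} \<subseteq> J \<union> J'" using R0 R1 by blast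
  then have R_cols: "card {j. \<exists>i. (i, j) \<in> R0 \<union> R1} \<le> n / d"
    by (rule cardnd[OF _ fin(2) finI'(2) cardII'(2)])
  have "{i. \<exists>j. (i, j) \<in> C0 \<union> C1} \<subseteq> I \<union> I'" using C0 C1 by blast
  then have C_rows: "card {i. \<exists>j. (i, j) \<in> C0 \<union> C1} \<le> n / d"
    by (rule cardnd[OF _ fin(1) finI'(1) cardII'(1)])
  show ?thesis
    by (rule that[OF _ disj rows cols R_cols C_rows]) (use union in \<open>simp only: E_def\<close>)
qed

subsection \<open>Norm bounds\<close>

definition light_concentration :: "nat \<Rightarrow> real \<Rightarrow> real \<Rightarrow> matrix \<Rightarrow> matrix \<Rightarrow> bool" where
  "light_concentration n d r p A \<longleftrightarrow> (\<forall>x\<in>dyadic_net n. \<forall>y\<in>dyadic_net n.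
     (\<Sum>(i, j)\<in>grid n. (if \<bar>x i * y j\<bar> \<le> sqrt d / n then x i * y j else 0) * (A (i, j) - p (i, j)))
       \<le> 39 * r * sqrt d)"

lemma dyadic_net_sum_squares: "x \<in> dyadic_net n \<Longrightarrow> (\<Sum>i=1..n. (x i)\<^sup>2) \<le> 1"
  by (simp add: dyadic_net_def)

lemma sum_grid_squares_le:
  assumes "x \<in> dyadic_net n" "y \<in> dyadic_net n"
  shows "(\<Sum>(i, j)\<in>grid n. (x i)\<^sup>2 * (y j)\<^sup>2) \<le> 1"
proof -
  have "(\<Sum>(i, j)\<in>grid n. (x i)\<^sup>2 * (y j)\<^sup>2) = (\<Sum>i=1..n. (x i)\<^sup>2) * (\<Sum>j=1..n. (y j)\<^sup>2)"
    by (simp add: grid_def sum_product sum.cartesian_product)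
  also have "\<dots> \<le> 1 * 1"
    using assms[THEN dyadic_net_sum_squares] by (intro mult_mono) (auto intro: sum_nonneg)
  finally show ?thesis by simp
qed

text \<open>Weighted arithmetic-geometric mean with a free weight \<open>c\<close>. For
  \<open>k\<close> full rows, \<open>c = 1 / d\<close> gives \<open>1 + k * d^2 / n\<close>; for
  full columns, \<open>c = d\<close> does the same.\<close>

lemma sum_rectangle_le:
  fixes c d :: real
  assumes n: "n \<ge> 1" and d: "d > 0" and c: "c > 0" and x: "x \<in> dyadic_net n" and y: "y \<in> dyadic_net n"
    and IJ: "I \<subseteq> {1..n}" "J \<subseteq> {1..n}"
  shows "(\<Sum>(i, j)\<in>I \<times> J. \<bar>x i * y j\<bar> * (d / n)) \<le> (d / n) * (real (card J) * c + real (card I) / c)"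
proof -
  have fin: "finite I" "finite J" using IJ finite_subset by blast+
  have xI: "(\<Sum>i\<in>I. (x i)\<^sup>2) \<le> 1"
    using sum_mono2[of "{1..n}" I "\<lambda>i. (x i)\<^sup>2"] IJ dyadic_net_sum_squares[OF x] by simp
  have yJ: "(\<Sum>j\<in>J. (y j)\<^sup>2) \<le> 1"
    using sum_mono2[of "{1..n}" J "\<lambda>j. (y j)\<^sup>2"] IJ dyadic_net_sum_squares[OF y] by simp
  have amgm: "\<bar>a * b\<bar> \<le> c * a\<^sup>2 + b\<^sup>2 / c" for a b :: real
  proof -
    have "0 \<le> (c * \<bar>a\<bar> - \<bar>b\<bar>)\<^sup>2" by simp
    also have "\<dots> = c\<^sup>2 * a\<^sup>2 - 2 * (c * \<bar>a * b\<bar>) + b\<^sup>2"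
      by (simp add: power2_diff power_mult_distrib abs_mult)
    finally have "c * (2 * \<bar>a * b\<bar>) \<le> c * (c * a\<^sup>2 + b\<^sup>2 / c)"
      using c by (simp add: power2_eq_square distrib_left)
    then have "2 * \<bar>a * b\<bar> \<le> c * a\<^sup>2 + b\<^sup>2 / c" using c by simp
    then show ?thesis by linarith
  qed
  have "(\<Sum>(i, j)\<in>I \<times> J. \<bar>x i * y j\<bar> * (d / n)) \<le> (\<Sum>(i, j)\<in>I \<times> J. (c * (x i)\<^sup>2 + (y j)\<^sup>2 / c) * (d / n))"
    using d by (intro sum_mono) (auto intro!: mult_right_mono amgm simp del: times_divide_eq_right)
  also have "\<dots> = (\<Sum>(i, j)\<in>I \<times> J. c * (x i)\<^sup>2 + (y j)\<^sup>2 / c) * (d / n)"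
    by (simp only: sum_distrib_right case_prod_unfold)
  also have "\<dots> = (\<Sum>i\<in>I. \<Sum>j\<in>J. (c * (x i)\<^sup>2 + (y j)\<^sup>2 / c)) * (d / n)"
    by (simp only: sum.cartesian_product)
  finally have le: "(\<Sum>(i, j)\<in>I \<times> J. \<bar>x i * y j\<bar> * (d / n)) \<le>
      (\<Sum>i\<in>I. \<Sum>j\<in>J. (c * (x i)\<^sup>2 + (y j)\<^sup>2 / c)) * (d / n)" .
  have "(\<Sum>i\<in>I. \<Sum>j\<in>J. (c * (x i)\<^sup>2 + (y j)\<^sup>2 / c)) =
      card J * c * (\<Sum>i\<in>I. (x i)\<^sup>2) + card I / c * (\<Sum>j\<in>J. (y j)\<^sup>2)"
    by (simp add: sum.distrib sum_distrib_left mult_ac flip: sum_divide_distrib)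
  also have "\<dots> \<le> card J * c * 1 + card I / c * 1"
    using xI yJ c by (intro add_mono mult_left_mono) auto
  finally have "(\<Sum>i\<in>I. \<Sum>j\<in>J. (c * (x i)\<^sup>2 + (y j)\<^sup>2 / c)) * (d / n) \<le>
      (card J * c * 1 + card I / c * 1) * (d / n)"
    using d by (intro mult_right_mono) auto
  with le show ?thesis by (simp add: mult.commute)
qed

text \<open>The bilinear form is bounded entrywise by five terms: light pairs, ones at heavy pairs,
  means at heavy pairs, and the zeros in discarded rows and in discarded columns. They contribute
  \<open>39 + 411 + 1 + 3 / 2 + 3 / 2 = 454\<close>.\<close>

lemma spectral_norm_dense:
  fixes d r :: real
  assumes n: "n \<ge> 1" and d: "d \<ge> 1" and r: "r \<ge> 1" and disc: "discrepancy n d r A"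
    and A: "\<And>e. A e \<in> {0, 1}" and p: "\<And>e. e \<in> grid n \<Longrightarrow> 0 \<le> p e \<and> p e \<le> 1 \<and> real n * p e \<le> d"
    and light: "light_concentration n d r p A"
    and I: "I = {i\<in>{1..n}. 8 * r * d < (\<Sum>j=1..n. A (i, j))}" "2 * real (card I) * d\<^sup>2 \<le> n"
    and J: "J = {j\<in>{1..n}. 8 * r * d < (\<Sum>i=1..n. A (i, j))}" "2 * real (card J) * d\<^sup>2 \<le> n"
  shows "spectral_norm n (restr (\<lambda>e. A e - p e) (grid n - {(i, j) \<in> grid n. A (i, j) = 1 \<and> (i \<in> I \<or> j \<in> J)}))
    \<le> 25 / 4 * (454 * r * sqrt d)"
proof (rule spectral_norm_le_dyadic_net[OF n])
  fix x y assume x: "x \<in> dyadic_net n" and y: "y \<in> dyadic_net n"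
  define B where "B = restr (\<lambda>e. A e - p e) (grid n - {(i, j) \<in> grid n. A (i, j) = 1 \<and> (i \<in> I \<or> j \<in> J)})"
  \<comment> \<open>Although \<open>I\<close> depends on \<open>A\<close>, \<open>x'\<close> is
    again a net point, so \<open>light\<close> applies to it.\<close>
  define x' where "x' = (\<lambda>i\<in>{1..n}. if i \<in> I then 0 else x i)"
  define y' where "y' = (\<lambda>j\<in>{1..n}. if j \<in> J then 0 else y j)"
  have x': "x' \<in> dyadic_net n" and y': "y' \<in> dyadic_net n"
    unfolding x'_def y'_def using x y by (simp_all only: dyadic_net_zero_out)
  define t where "t = sqrt d / n"
  have n0: "real n > 0" and sd: "sqrt d > 0" "sqrt d * sqrt d = d" "sqrt d \<ge> 1" using n d by auto
  have t: "t > 0" using n0 sd by (simp add: t_def)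
  have dn: "d / n = sqrt d * t" using sd(2) by (simp add: t_def)
  define S where "S = {1..n} - I"
  define S' where "S' = {1..n} - J"
  define H where "H = {(i, j) \<in> S \<times> S'. t < \<bar>x' i * y' j\<bar>}"
  have HG: "H \<subseteq> grid n" by (auto simp: H_def S_def S'_def grid_def)
  have pd: "p e \<le> d / n" if "e \<in> grid n" for e using p[OF that] n0 by (simp add: field_simps)
  have IJ: "I \<subseteq> {1..n}" "J \<subseteq> {1..n}" using I J by auto
  have pointwise: "x i * B (i, j) * y j \<le>
      (if \<bar>x' i * y' j\<bar> \<le> t then x' i * y' j else 0) * (A (i, j) - p (i, j))
      + (if (i, j) \<in> H then \<bar>x' i * y' j\<bar> * A (i, j) else 0)
      + sqrt d * ((x' i)\<^sup>2 * (y' j)\<^sup>2)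
      + (if (i, j) \<in> I \<times> {1..n} then \<bar>x i * y j\<bar> * (d / n) else 0)
      + (if (i, j) \<in> {1..n} \<times> J then \<bar>x i * y j\<bar> * (d / n) else 0)" (is "_ \<le> ?rhs i j")
    if ij: "(i, j) \<in> grid n" for i j
  proof (cases "i \<in> I \<or> j \<in> J")
    case True
    have z: "x' i * y' j = 0" "(x' i)\<^sup>2 * (y' j)\<^sup>2 = 0" "(i, j) \<notin> H"
      using True ij by (auto simp: x'_def y'_def grid_def H_def S_def S'_def)
    define w where "w = \<bar>x i * y j\<bar> * (d / n)"
    have w: "0 \<le> w" using d by (simp add: w_def)
    have "x i * B (i, j) * y j \<le> \<bar>x i * y j\<bar> * (d / n)"
    proof (cases "A (i, j) = 1")
      case a: True
      then have "B (i, j) = 0" using True ij by (auto simp: B_def restr_def)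
      then show ?thesis using d by simp
    next
      case False
      then have "A (i, j) = 0" using A[of "(i, j)"] by auto
      then have "B (i, j) = - p (i, j)" using ij by (auto simp: B_def restr_def)
      then have "x i * B (i, j) * y j = - (x i * y j) * p (i, j)" by simp
      also have "\<dots> \<le> \<bar>x i * y j\<bar> * p (i, j)" using p[OF ij] by (intro mult_right_mono) auto
      also have "\<dots> \<le> \<bar>x i * y j\<bar> * (d / n)" using pd[OF ij] by (intro mult_left_mono) auto
      finally show ?thesis .
    qed
    then show ?thesis unfolding w_def[symmetric] using w z True ij t by (auto simp: grid_def)
  next
    case False
    have eq: "x' i = x i" "y' j = y j" using False ij by (auto simp: x'_def y'_def grid_def)
    have "B (i, j) = A (i, j) - p (i, j)" using False ij by (auto simp: B_def restr_def)
    then have B: "x i * B (i, j) * y j = x' i * y' j * (A (i, j) - p (i, j))" by (simp add: eq)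
    have "x' i * y' j * (A (i, j) - p (i, j)) \<le>
      (if \<bar>x' i * y' j\<bar> \<le> t then x' i * y' j else 0) * (A (i, j) - p (i, j))
      + (if (i, j) \<in> H then \<bar>x' i * y' j\<bar> * A (i, j) else 0) + sqrt d * ((x' i)\<^sup>2 * (y' j)\<^sup>2)"
    proof (cases "\<bar>x' i * y' j\<bar> \<le> t")
      case True
      then show ?thesis using sd A[of "(i, j)"] by auto
    next
      case big: False
      then have "(i, j) \<in> H" using False ij by (auto simp: H_def S_def S'_def grid_def)
      moreover have "x' i * y' j * A (i, j) \<le> \<bar>x' i * y' j\<bar> * A (i, j)"
        using A[of "(i, j)"] by (intro mult_right_mono) auto
      \<comment> \<open>One factor of the mean bound \<open>d / n = sqrt d * t\<close> is the
        threshold \<open>t\<close>, which a heavy product exceeds.\<close>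
      moreover have "- (x' i * y' j) * p (i, j) \<le> sqrt d * ((x' i)\<^sup>2 * (y' j)\<^sup>2)"
      proof -
        let ?z = "\<bar>x' i * y' j\<bar>"
        have "- (x' i * y' j) * p (i, j) \<le> ?z * p (i, j)"
          using p[OF ij] by (intro mult_right_mono) auto
        also have "\<dots> \<le> ?z * (d / n)" using pd[OF ij] by (intro mult_left_mono) auto
        also have "\<dots> = sqrt d * (?z * t)" by (simp only: dn mult.left_commute)
        also have "\<dots> \<le> sqrt d * (?z * ?z)" using big sd by (intro mult_left_mono) auto
        also have "?z * ?z = (x' i)\<^sup>2 * (y' j)\<^sup>2" by (simp add: power_mult_distrib flip: power2_eq_square)
        finally show ?thesis .
      qed
      ultimately show ?thesis using big by (simp add: right_diff_distrib)
    qed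
    then show ?thesis using B False by simp
  qed
  have s1: "(\<Sum>(i, j)\<in>grid n. (if \<bar>x' i * y' j\<bar> \<le> t then x' i * y' j else 0) * (A (i, j) - p (i, j))) \<le> 39 * r * sqrt d"
    using light x' y' unfolding light_concentration_def t_def by blast
  have "(\<Sum>(i, j)\<in>grid n. if (i, j) \<in> H then \<bar>x' i * y' j\<bar> * A (i, j) else 0) = (\<Sum>(i, j)\<in>H. \<bar>x' i * y' j\<bar> * A (i, j))"
    using HG by (intro sum.mono_neutral_cong_right) auto
  also have "\<dots> \<le> 411 * r * sqrt d" unfolding H_def t_def
    using n d r x' y' A disc by (intro sum_heavy_le) (auto simp: S_def S'_def I(1) J(1))
  finally have s2: "(\<Sum>(i, j)\<in>grid n. if (i, j) \<in> H then \<bar>x' i * y' j\<bar> * A (i, j) else 0) \<le> 411 * r * sqrt d" .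
  have "(\<Sum>(i, j)\<in>grid n. sqrt d * ((x' i)\<^sup>2 * (y' j)\<^sup>2)) = sqrt d * (\<Sum>(i, j)\<in>grid n. (x' i)\<^sup>2 * (y' j)\<^sup>2)"
    by (simp add: sum_distrib_left case_prod_unfold)
  also have "\<dots> \<le> sqrt d * 1" using sum_grid_squares_le[OF x' y'] sd by (intro mult_left_mono) auto
  finally have s3: "(\<Sum>(i, j)\<in>grid n. sqrt d * ((x' i)\<^sup>2 * (y' j)\<^sup>2)) \<le> sqrt d" by simp
  have "(\<Sum>(i, j)\<in>grid n. if (i, j) \<in> I \<times> {1..n} then \<bar>x i * y j\<bar> * (d / n) else 0) = (\<Sum>(i, j)\<in>I \<times> {1..n}. \<bar>x i * y j\<bar> * (d / n))"
    using IJ by (intro sum.mono_neutral_cong_right) (auto simp: grid_def split: if_splits)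
  also have "\<dots> \<le> (d / n) * (real (card {1..n}) * (1 / d) + real (card I) / (1 / d))"
    using n d x y IJ by (intro sum_rectangle_le) auto
  also have "\<dots> = 1 + real (card I) * d\<^sup>2 / n" using n0 d by (simp add: field_simps power2_eq_square)
  also have "\<dots> \<le> 3 / 2" using I(2) n0 by (simp add: field_simps)
  finally have s4: "(\<Sum>(i, j)\<in>grid n. if (i, j) \<in> I \<times> {1..n} then \<bar>x i * y j\<bar> * (d / n) else 0) \<le> 3 / 2" .
  have "(\<Sum>(i, j)\<in>grid n. if (i, j) \<in> {1..n} \<times> J then \<bar>x i * y j\<bar> * (d / n) else 0) = (\<Sum>(i, j)\<in>{1..n} \<times> J. \<bar>x i * y j\<bar> * (d / n))"
    using IJ by (intro sum.mono_neutral_cong_right) (auto simp: grid_def split: if_splits)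
  also have "\<dots> \<le> (d / n) * (real (card J) * d + real (card {1..n}) / d)"
    using n d x y IJ by (intro sum_rectangle_le) auto
  also have "\<dots> = 1 + real (card J) * d\<^sup>2 / n" using n0 d by (simp add: field_simps power2_eq_square)
  also have "\<dots> \<le> 3 / 2" using J(2) n0 by (simp add: field_simps)
  finally have s5: "(\<Sum>(i, j)\<in>grid n. if (i, j) \<in> {1..n} \<times> J then \<bar>x i * y j\<bar> * (d / n) else 0) \<le> 3 / 2" .
  have "(\<Sum>i=1..n. \<Sum>j=1..n. x i * B (i, j) * y j) = (\<Sum>(i, j)\<in>grid n. x i * B (i, j) * y j)"
    by (simp add: grid_def sum.cartesian_product)
  also have "\<dots> \<le> (\<Sum>(i, j)\<in>grid n. ?rhs i j)"
    using pointwise by (intro sum_mono) auto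
  also have "\<dots> \<le> 39 * r * sqrt d + 411 * r * sqrt d + sqrt d + 3 / 2 + 3 / 2"
    using s1 s2 s3 s4 s5 by (simp add: case_prod_unfold sum.distrib)
  also have "\<dots> \<le> 39 * r * sqrt d + 411 * r * sqrt d + 4 * sqrt d" using sd by simp
  also have "\<dots> \<le> 454 * (r * sqrt d)" using r sd by simp
  finally show "(\<Sum>i=1..n. \<Sum>j=1..n. x i * B (i, j) * y j) \<le> 454 * r * sqrt d" by simp
qed

text \<open>With all ones removed, the entries are at most \<open>d / n\<close> in absolute value,
  so the norm is of order \<open>d\<close>, and \<open>d \<le> sqrt d\<close> for
  \<open>d \<le> 1\<close>.\<close>

lemma spectral_norm_sparse:
  fixes d :: real
  assumes n: "n \<ge> 1" and d: "0 < d" "d \<le> 1"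
    and A: "\<And>e. A e \<in> {0, 1}" and p: "\<And>e. e \<in> grid n \<Longrightarrow> 0 \<le> p e \<and> p e \<le> 1 \<and> real n * p e \<le> d"
  shows "spectral_norm n (restr (\<lambda>e. A e - p e) (grid n - {e \<in> grid n. A e = 1})) \<le> 25 / 4 * (2 * sqrt d)"
proof (rule spectral_norm_le_dyadic_net[OF n])
  fix x y assume x: "x \<in> dyadic_net n" and y: "y \<in> dyadic_net n"
  define B where "B = restr (\<lambda>e. A e - p e) (grid n - {e \<in> grid n. A e = 1})"
  have n0: "real n > 0" using n by simp
  have "x i * B (i, j) * y j \<le> \<bar>x i * y j\<bar> * (d / n)" if ij: "(i, j) \<in> grid n" for i j
  proof -
    have "\<bar>B (i, j)\<bar> \<le> p (i, j)" using A[of "(i, j)"] p[OF ij] by (auto simp: B_def restr_def)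
    also have "\<dots> \<le> d / n" using p[OF ij] n0 by (simp add: field_simps)
    finally have "\<bar>x i * y j\<bar> * \<bar>B (i, j)\<bar> \<le> \<bar>x i * y j\<bar> * (d / n)" by (intro mult_left_mono) auto
    moreover have "x i * B (i, j) * y j \<le> \<bar>x i * B (i, j) * y j\<bar>" by simp
    ultimately show ?thesis by (simp add: abs_mult mult_ac)
  qed
  then have "(\<Sum>(i, j)\<in>grid n. x i * B (i, j) * y j) \<le> (\<Sum>(i, j)\<in>grid n. \<bar>x i * y j\<bar> * (d / n))"
    by (intro sum_mono) auto
  also have "\<dots> \<le> (d / n) * (real (card {1..n}) * 1 + real (card {1..n}) / 1)"
    unfolding grid_def using n d x y by (intro sum_rectangle_le) auto
  also have "\<dots> = 2 * d" using n0 by simp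
  also have "\<dots> \<le> 2 * sqrt d"
  proof -
    have "sqrt d * sqrt d \<le> sqrt d * 1" using d by (intro mult_left_mono) auto
    then show ?thesis using d by simp
  qed
  finally show "(\<Sum>i=1..n. \<Sum>j=1..n. x i * B (i, j) * y j) \<le> 2 * sqrt d"
    by (simp add: grid_def sum.cartesian_product)
qed

subsection \<open>Probabilities of the exceptional events\<close>

lemma prob_UN_le:
  fixes M :: "'a pmf"
  assumes "finite X" and "S \<subseteq> (\<Union>x\<in>X. B x)" and "\<And>x. x \<in> X \<Longrightarrow> measure_pmf.prob M (B x) \<le> c x"
  shows "measure_pmf.prob M S \<le> (\<Sum>x\<in>X. c x)"
proof -
  have "measure_pmf.prob M S \<le> measure_pmf.prob M (\<Union>x\<in>X. B x)"
    using assms(2) by (intro measure_pmf.finite_measure_mono) auto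
  also have "\<dots> \<le> (\<Sum>x\<in>X. measure_pmf.prob M (B x))"
    using assms(1) by (intro measure_pmf.finite_measure_subadditive_finite) auto
  also have "\<dots> \<le> (\<Sum>x\<in>X. c x)" using assms(3) by (rule sum_mono)
  finally show ?thesis .
qed

lemma exp_minus_1_le_half: "exp (- 1 :: real) \<le> 1 / 2"
  using exp_ge_add_one_self[of "1::real"] by (simp add: exp_minus field_simps)

text \<open>The threshold \<open>sqrt d / n\<close> makes the rescaled weights \<open>w\<close> at
  most 1 in absolute value, so \<open>exp w - 1 \<le> w + w^2\<close>, and the quadratic part sums
  to at most \<open>n\<close>. Of the exponent 39, the two nets use \<open>18 + 18\<close>, the
  quadratic part 1, and the remaining 2 cover \<open>r * ln n + 1\<close>.\<close>

lemma prob_not_light_concentration: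
  fixes d r :: real
  assumes n: "n \<ge> 1" and d: "d > 0" and r: "r \<ge> 1"
    and p: "\<And>e. e \<in> grid n \<Longrightarrow> 0 \<le> p e \<and> p e \<le> 1 \<and> real n * p e \<le> d"
  shows "measure_pmf.prob (er n p) {A. \<not> light_concentration n d r p A} \<le> real n powr (- r) / 2"
proof -
  let ?T = "dyadic_net n"
  have n0: "real n > 0" and sd: "sqrt d > 0" "sqrt d * sqrt d = d" using n d by auto
  define z where "z x y = (\<lambda>(i, j). if \<bar>x i * y j\<bar> \<le> sqrt d / n then x i * y j else 0 :: real)" for x y :: "nat \<Rightarrow> real"
  define S where "S = (\<lambda>(x, y). {A. 39 * r * sqrt d < (\<Sum>e\<in>grid n. z x y e * (A e - p e))})"
  have bound: "measure_pmf.prob (er n p) (S (x, y)) \<le> exp (n - 39 * r * n)" if x: "x \<in> ?T" and y: "y \<in> ?T" for x y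
  proof -
    define w where "w e = (n / sqrt d) * z x y e" for e
    have w1: "\<bar>w e\<bar> \<le> 1" for e
    proof -
      have "\<bar>z x y e\<bar> \<le> sqrt d / n" using d by (cases e) (auto simp: z_def)
      then have "(n / sqrt d) * \<bar>z x y e\<bar> \<le> (n / sqrt d) * (sqrt d / n)"
        using sd n0 by (intro mult_left_mono) auto
      then show ?thesis using sd n0 by (simp add: w_def abs_mult)
    qed
    have "(\<Sum>e\<in>grid n. p e * (w e)\<^sup>2) \<le> (\<Sum>(i, j)\<in>grid n. n * ((x i)\<^sup>2 * (y j)\<^sup>2))"
    proof (intro sum_mono, clarify)
      fix i j assume ij: "(i, j) \<in> grid n"
      have "(w (i, j))\<^sup>2 = (real n)\<^sup>2 / d * (z x y (i, j))\<^sup>2"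
        using d by (simp add: w_def power_mult_distrib power_divide)
      also have "\<dots> \<le> (real n)\<^sup>2 / d * ((x i)\<^sup>2 * (y j)\<^sup>2)"
        using d by (intro mult_left_mono) (auto simp: z_def power_mult_distrib)
      finally have "p (i, j) * (w (i, j))\<^sup>2 \<le> (d / n) * ((real n)\<^sup>2 / d * ((x i)\<^sup>2 * (y j)\<^sup>2))"
        using p[OF ij] n0 d by (intro mult_mono) (auto simp: field_simps)
      also have "\<dots> = n * ((x i)\<^sup>2 * (y j)\<^sup>2)" using n0 d by (simp add: power2_eq_square)
      finally show "p (i, j) * (w (i, j))\<^sup>2 \<le> n * ((x i)\<^sup>2 * (y j)\<^sup>2)" .
    qed
    also have "\<dots> = n * (\<Sum>(i, j)\<in>grid n. (x i)\<^sup>2 * (y j)\<^sup>2)"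
      by (simp only: sum_distrib_left case_prod_unfold)
    also have "\<dots> \<le> real n * 1" using sum_grid_squares_le[OF x y] by (intro mult_left_mono) auto
    finally have var: "(\<Sum>e\<in>grid n. p e * (w e)\<^sup>2) \<le> n" by simp
    define t where "t = 39 * r * n + (\<Sum>e\<in>grid n. w e * p e)"
    have sub: "S (x, y) \<subseteq> {A. t \<le> (\<Sum>e\<in>grid n. w e * A e)}"
    proof
      fix A assume "A \<in> S (x, y)"
      then have "39 * r * sqrt d < (\<Sum>e\<in>grid n. z x y e * (A e - p e))" by (simp add: S_def)
      then have "(n / sqrt d) * (39 * r * sqrt d) \<le> (n / sqrt d) * (\<Sum>e\<in>grid n. z x y e * (A e - p e))"
        using sd n0 by (intro mult_left_mono) auto
      moreover have "(n / sqrt d) * (\<Sum>e\<in>grid n. z x y e * (A e - p e)) = (\<Sum>e\<in>grid n. w e * A e) - (\<Sum>e\<in>grid n. w e * p e)"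
        unfolding sum_distrib_left sum_subtractf[symmetric] w_def by (intro sum.cong) (auto simp: algebra_simps)
      moreover have "(n / sqrt d) * (39 * r * sqrt d) = 39 * r * n" using sd by simp
      ultimately show "A \<in> {A. t \<le> (\<Sum>e\<in>grid n. w e * A e)}"
        unfolding t_def mem_Collect_eq by linarith
    qed
    have "measure_pmf.prob (er n p) (S (x, y)) \<le> measure_pmf.prob (er n p) {A. t \<le> (\<Sum>e\<in>grid n. w e * A e)}"
      using sub by (intro measure_pmf.finite_measure_mono) auto
    also have "\<dots> \<le> exp ((\<Sum>e\<in>grid n. p e * (exp (w e) - 1)) - t)"
      using p by (intro er_exponential_tail) auto
    also have "\<dots> \<le> exp (n - 39 * r * n)"
    proof -
      have "(\<Sum>e\<in>grid n. p e * (exp (w e) - 1)) \<le> (\<Sum>e\<in>grid n. p e * (w e + (w e)\<^sup>2))"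
        using p exp_le_one_plus_square[OF w1] by (intro sum_mono mult_left_mono) (auto simp: algebra_simps)
      also have "\<dots> = (\<Sum>e\<in>grid n. w e * p e) + (\<Sum>e\<in>grid n. p e * (w e)\<^sup>2)"
        by (simp add: sum.distrib algebra_simps)
      finally show ?thesis using var by (simp add: t_def)
    qed
    finally show ?thesis .
  qed
  have "measure_pmf.prob (er n p) {A. \<not> light_concentration n d r p A} \<le> (\<Sum>w\<in>?T \<times> ?T. exp (n - 39 * r * n))"
  proof (rule prob_UN_le)
    show "finite (?T \<times> ?T)" by (simp add: finite_dyadic_net)
    show "{A. \<not> light_concentration n d r p A} \<subseteq> (\<Union>w\<in>?T \<times> ?T. S w)"
    proof
      fix A assume "A \<in> {A. \<not> light_concentration n d r p A}"
      then obtain x y where xy: "x \<in> ?T" "y \<in> ?T"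
        and big: "39 * r * sqrt d < (\<Sum>(i, j)\<in>grid n.
          (if \<bar>x i * y j\<bar> \<le> sqrt d / n then x i * y j else 0) * (A (i, j) - p (i, j)))"
        unfolding light_concentration_def mem_Collect_eq not_le by (meson not_le)
      have "(\<Sum>(i, j)\<in>grid n. (if \<bar>x i * y j\<bar> \<le> sqrt d / n then x i * y j else 0) * (A (i, j) - p (i, j)))
          = (\<Sum>e\<in>grid n. z x y e * (A e - p e))"
        by (intro sum.cong refl) (simp add: z_def case_prod_unfold)
      then have "A \<in> S (x, y)" using big by (simp only: S_def mem_Collect_eq prod.case)
      then show "A \<in> (\<Union>w\<in>?T \<times> ?T. S w)" using xy by blast
    qed
    show "measure_pmf.prob (er n p) (S w) \<le> exp (n - 39 * r * n)" if "w \<in> ?T \<times> ?T" for w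
      using bound that by auto
  qed
  also have "\<dots> = real (card ?T) * real (card ?T) * exp (n - 39 * r * n)" by (simp add: card_cartesian_product)
  also have "\<dots> \<le> exp (18 * n) * exp (18 * n) * exp (n - 39 * r * n)"
    using card_dyadic_net[OF n] by (intro mult_mono) auto
  also have "\<dots> = exp (37 * n - 39 * r * n)" by (simp flip: exp_add)
  also have "\<dots> \<le> exp (- r * ln n + (- 1))"
  proof -
    have "ln (real n) \<le> real n" using n0 ln_le_minus_one[of "real n"] by linarith
    then have "r * ln n \<le> r * n" using r by (intro mult_left_mono) auto
    moreover have "37 * real n + 1 \<le> 38 * (r * n)"
    proof -
      have "1 * real n \<le> r * n" using r by (intro mult_right_mono) auto
      moreover have "real n \<ge> 1" using n by simp
      ultimately show ?thesis by linarith
    qed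
    ultimately show ?thesis by simp
  qed
  also have "\<dots> = real n powr (- r) * exp (- 1)"
    using n0 by (simp add: powr_def flip: exp_add)
  also have "\<dots> \<le> real n powr (- r) * (1 / 2)"
    using exp_minus_1_le_half by (intro mult_left_mono) auto
  finally show ?thesis by simp
qed

text \<open>\<open>L i\<close> is the \<open>i\<close>-th row or the \<open>i\<close>-th column of the grid.\<close>

lemma prob_many_heavy_lines:
  fixes d r :: real and L :: "nat \<Rightarrow> (nat \<times> nat) set"
  assumes n: "n \<ge> 1" and d: "d \<ge> 1" and r: "r \<ge> 1"
    and p: "\<And>e. e \<in> grid n \<Longrightarrow> 0 \<le> p e \<and> p e \<le> 1 \<and> real n * p e \<le> d"
    and L: "\<And>i. i \<in> {1..n} \<Longrightarrow> L i \<subseteq> grid n \<and> card (L i) = n" and disj: "disjoint_family L"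
  shows "measure_pmf.prob (er n p) {A. \<not> 2 * real (card {i\<in>{1..n}. 8 * r * d < sum A (L i)}) * d\<^sup>2 \<le> n}
    \<le> real n powr (- r) / 2"
proof -
  have n0: "real n > 0" and d0: "d > 0" using n d by auto
  \<comment> \<open>More than \<open>n / (2 * d^2)\<close> heavy lines include exactly
    \<open>k\<close> of them, so the union bound runs over sets of a single size.\<close>
  define k where "k = nat \<lceil>n / (2 * d\<^sup>2)\<rceil>"
  have kpos: "n / (2 * d\<^sup>2) > 0" using n0 d0 by simp
  have k_ge: "n / (2 * d\<^sup>2) \<le> k" unfolding k_def by (rule real_nat_ceiling_ge)
  have k1: "k \<ge> 1" using k_ge kpos by (cases k) auto
  have d2: "1 \<le> d\<^sup>2" using d by (simp add: one_le_power)
  have "n / (2 * d\<^sup>2) \<le> n / 1" using d2 n0 by (intro divide_left_mono) auto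
  then have kn: "k \<le> n" unfolding k_def by (simp add: nat_le_iff ceiling_le_iff)
  define X where "X = {I. I \<subseteq> {1..n} \<and> card I = k}"
  define S where "S I = (\<Union>i\<in>I. L i)" for I
  define s where "s = 8 * r * d * k"
  \<comment> \<open>\<open>n / k \<le> 2 * d^2\<close>, so the entropy is at most linear in
    \<open>d\<close>, like the exponent of the tail.\<close>
  have ent: "entropy n k \<le> k * (2 * d)"
  proof -
    have "ln (n / k) \<le> ln (2 * d\<^sup>2)"
      using k_ge k1 n0 d0 by (intro ln_mono) (auto simp: field_simps)
    also have "\<dots> = ln 2 + 2 * ln d" using d0 by (simp add: ln_mult ln_realpow)
    also have "\<dots> \<le> 1 + 2 * (d - 1)"
      using ln_le_minus_one[of d] ln_le_minus_one[of "2::real"] d0 by (intro add_mono) auto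
    finally show ?thesis by (simp add: entropy_def mult_left_mono)
  qed
  \<comment> \<open>The degree threshold \<open>8 * r * d\<close> gives excess ratio
    \<open>8 * r / e\<close>, whose logarithm is at least \<open>1 / 2\<close>; the exponent
    \<open>s / 2 = 4 * r * d * k\<close> is at least \<open>2 * r\<close> entropies. One entropy
    pays for the choice of \<open>I\<close>, and \<open>r\<close> of them remain.\<close>
  have bound: "measure_pmf.prob (er n p) {A. s \<le> sum A (S I)} \<le> exp (- (2 * r * entropy n k))" if I: "I \<in> X" for I
  proof -
    have finI: "finite I" using I finite_subset by (auto simp: X_def)
    have LI: "\<And>i. i \<in> I \<Longrightarrow> L i \<subseteq> grid n \<and> card (L i) = n" using I L unfolding X_def by blast
    have finL: "finite (L i)" if "i \<in> I" for i
      using LI[OF that] finite_subset[OF _ finite_grid, of "L i" n] by simp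
    have "card (S I) = (\<Sum>i\<in>I. card (L i))"
      unfolding S_def using finI finL disj by (intro card_UN_disjoint) (auto simp: disjoint_family_on_def)
    then have card: "card (S I) = k * n" using LI I by (simp add: X_def)
    have sub: "S I \<subseteq> grid n" using LI by (auto simp: S_def)
    have "card (S I) > 0" using card k1 n by simp
    then have ne: "S I \<noteq> {}" by auto
    have \<mu>: "real (card (S I)) * d / n = k * d" using card n0 by simp
    have q: "exp (1::real) \<le> (8 * r / exp 1)\<^sup>2"
    proof -
      have "8 / 3 \<le> 8 * r / exp 1" using r exp_1_le_3 by (intro frac_le) auto
      then have "(8 / 3)\<^sup>2 \<le> (8 * r / exp 1)\<^sup>2" by (intro power_mono) auto
      then show ?thesis using exp_1_le_3 by (simp add: power2_eq_square)
    qed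
    have "exp 1 * (k * d) \<le> 8 * r * (k * d)" using exp_1_le_3 r d0 by (intro mult_right_mono) auto
    then have s: "exp 1 * (real (card (S I)) * d / n) \<le> s" unfolding \<mu> by (simp add: s_def mult_ac)
    have "measure_pmf.prob (er n p) {A. s \<le> sum A (S I)} \<le> exp (- (s * ln (s / (exp 1 * (k * d)))))"
      using er_edge_count_tail[OF p n d0 sub ne s] unfolding \<mu> by simp
    also have "s / (exp 1 * (k * d)) = 8 * r / exp 1" using d0 k1 by (simp add: s_def)
    also have "exp (- (s * ln (8 * r / exp 1))) \<le> exp (- (2 * r * entropy n k))"
    proof -
      have "ln (exp (1::real)) \<le> ln ((8 * r / exp 1)\<^sup>2)" using q r by (intro ln_mono) auto
      also have "\<dots> = 2 * ln (8 * r / exp 1)" using r by (subst ln_realpow) auto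
      finally have "1 / 2 \<le> ln (8 * r / exp 1)" by simp
      then have "s * (1 / 2) \<le> s * ln (8 * r / exp 1)"
        using r d0 by (intro mult_left_mono) (auto simp: s_def)
      moreover have "2 * r * entropy n k \<le> 2 * r * (k * (2 * d))" using ent r by (intro mult_left_mono) auto
      ultimately show ?thesis by (simp add: s_def)
    qed
    finally show ?thesis .
  qed
  have "measure_pmf.prob (er n p) {A. \<not> 2 * real (card {i\<in>{1..n}. 8 * r * d < sum A (L i)}) * d\<^sup>2 \<le> n}
      \<le> (\<Sum>I\<in>X. exp (- (2 * r * entropy n k)))"
  proof (rule prob_UN_le)
    show "finite X" unfolding X_def by (rule finite_subset[of _ "Pow {1..n}"]) auto
    show "{A. \<not> 2 * real (card {i\<in>{1..n}. 8 * r * d < sum A (L i)}) * d\<^sup>2 \<le> n} \<subseteq> (\<Union>I\<in>X. {A. s \<le> sum A (S I)})"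
    proof
      fix A assume "A \<in> {A. \<not> 2 * real (card {i\<in>{1..n}. 8 * r * d < sum A (L i)}) * d\<^sup>2 \<le> n}"
      then have "n / (2 * d\<^sup>2) < card {i\<in>{1..n}. 8 * r * d < sum A (L i)}"
        using d0 by (simp add: field_simps)
      then have "k \<le> card {i\<in>{1..n}. 8 * r * d < sum A (L i)}"
        unfolding k_def by (simp add: nat_le_iff ceiling_le_iff)
      then obtain I where I: "I \<subseteq> {i\<in>{1..n}. 8 * r * d < sum A (L i)}" "card I = k" "finite I"
        by (rule obtain_subset_with_card_n)
      have finL: "finite (L i)" if "i \<in> I" for i
        using L[of i] I(1) that finite_subset[OF _ finite_grid, of "L i" n] by auto
      have "s = (\<Sum>i\<in>I. 8 * r * d)" by (simp add: s_def I)
      also have "\<dots> \<le> (\<Sum>i\<in>I. sum A (L i))" using I by (intro sum_mono) auto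
      also have "\<dots> = sum A (S I)"
        unfolding S_def using I(3) finL disj
        by (intro sum.UNION_disjoint[symmetric]) (auto simp: disjoint_family_on_def)
      finally have "s \<le> sum A (S I)" .
      moreover have "I \<in> X" using I(1,2) by (auto simp: X_def)
      ultimately show "A \<in> (\<Union>I\<in>X. {A. s \<le> sum A (S I)})" by blast
    qed
  qed (use bound in auto)
  also have "\<dots> = real (n choose k) * exp (- (2 * r * entropy n k))"
    by (simp add: X_def n_subsets)
  also have "\<dots> \<le> exp (entropy n k) * exp (- (2 * r * entropy n k))"
    using binomial_le_exp_entropy[OF k1 kn] by (intro mult_right_mono) auto
  also have "\<dots> \<le> exp (- r * ln n + (- 1))"
  proof -
    have e: "1 + ln n \<le> entropy n k" using k1 kn by (intro entropy_ge) auto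
    have ln0: "0 \<le> ln (real n)" using n by simp
    have "1 * entropy n k \<le> r * entropy n k" using r e ln0 by (intro mult_right_mono) auto
    moreover have "r * (1 + ln n) \<le> r * entropy n k" using r e by (intro mult_left_mono) auto
    ultimately show ?thesis using r by (simp add: algebra_simps flip: exp_add)
  qed
  also have "\<dots> = real n powr (- r) * exp (- 1)"
    using n0 by (simp add: powr_def flip: exp_add)
  also have "\<dots> \<le> real n powr (- r) * (1 / 2)"
    using exp_minus_1_le_half by (intro mult_left_mono) auto
  finally show ?thesis by simp
qed

text \<open>The weight cancels the number of subsets of each size, so every size contributes at most
  1.\<close>

lemma sum_nonempty_subsets_entropy:
  "(\<Sum>I\<in>Pow {1..n} - {{}}. exp (- entropy (real n) (real (card I)))) \<le> real n"
proof -
  let ?X = "Pow {1..n} - {{}}"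
  have img: "card I \<in> {1..n}" if I: "I \<in> ?X" for I
  proof -
    have "finite I" using I by (auto intro: finite_subset)
    then have "card I \<ge> 1" using I by (simp add: Suc_le_eq card_gt_0_iff)
    moreover have "card I \<le> n" using card_mono[of "{1..n}" I] I by simp
    ultimately show ?thesis by simp
  qed
  have "(\<Sum>I\<in>?X. exp (- entropy (real n) (real (card I)))) =
      (\<Sum>k\<in>{1..n}. \<Sum>I\<in>{I\<in>?X. card I = k}. exp (- entropy (real n) (real (card I))))"
  proof (rule sum.group[of ?X "{1..n}" card, symmetric])
    show "card ` ?X \<subseteq> {1..n}" using img by blast
  qed simp_all
  also have "\<dots> \<le> (\<Sum>k\<in>{1..n}. 1)"
  proof (rule sum_mono)
    fix k assume k: "k \<in> {1..n}"
    have "{I\<in>Pow {1..n} - {{}}. card I = k} = {I. I \<subseteq> {1..n} \<and> card I = k}" using k by auto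
    then have "(\<Sum>I\<in>{I\<in>Pow {1..n} - {{}}. card I = k}. exp (- entropy n (card I))) = real (n choose k) * exp (- entropy n k)"
      by (simp add: n_subsets)
    also have "\<dots> \<le> exp (entropy n k) * exp (- entropy n k)"
      using binomial_le_exp_entropy[of k n] k by (intro mult_right_mono) auto
    also have "\<dots> = 1" by (simp flip: exp_add)
    finally show "(\<Sum>I\<in>{I\<in>Pow {1..n} - {{}}. card I = k}. exp (- entropy n (card I))) \<le> 1" .
  qed
  finally show ?thesis by simp
qed

text \<open>Of the \<open>7 * r\<close> entropies in the threshold, one is spent on weighting each
  of \<open>I\<close> and \<open>J\<close>; the others are at least
  \<open>(7 * r - 2) * (1 + ln n)\<close>. The sums over \<open>I\<close>, \<open>J\<close> and the
  edge count cost \<open>n\<close>, \<open>n\<close> and \<open>n^2\<close>, and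
  \<open>4 + 2 \<le> 6 * r\<close> leaves \<open>r * ln n\<close>.\<close>

lemma prob_not_discrepancy:
  fixes d r :: real
  assumes n: "n \<ge> 1" and d: "d > 0" and r: "r \<ge> 1"
    and p: "\<And>e. e \<in> grid n \<Longrightarrow> 0 \<le> p e \<and> p e \<le> 1 \<and> real n * p e \<le> d"
  shows "measure_pmf.prob (er n p) {A. \<not> discrepancy n d r A} \<le> real n powr (- r) / 2"
proof -
  have n0: "real n > 0" and ln0: "ln (real n) \<ge> 0" using n by auto
  let ?P = "Pow {1..n} - {{}}"
  define \<mu> where "\<mu> I J = real (card I) * real (card J) * d / n" for I J :: "nat set"
  define M where "M I J = max (real (card I)) (real (card J))" for I J :: "nat set"
  define Q where "Q I J s \<longleftrightarrow> exp 1 * \<mu> I J < s \<and> 7 * r * entropy n (M I J) < s * ln (s / (exp 1 * \<mu> I J))"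
    for I J and s :: real
  define w where "w I = exp (- entropy n (real (card I)))" for I :: "nat set"
  define K where "K = exp (- ((7 * r - 2) * (1 + ln n)))"
  \<comment> \<open>For fixed \<open>s\<close> the failure condition \<open>Q\<close> is
    deterministic, which leaves a plain tail event. Finitely many \<open>s\<close> suffice because
    on the support of the law the edge count is an integer.\<close>
  define B where "B = (\<lambda>(I, J, s :: nat). if Q I J s then {A :: matrix. s \<le> sum A (I \<times> J)} else {})"
  define c where "c = (\<lambda>(I, J, s :: nat). K * w I * w J)"
  have cardP: "1 \<le> card I \<and> card I \<le> n" if "I \<in> ?P" for I
  proof -
    have "finite I" using that by (auto intro: finite_subset)
    then show ?thesis using that card_mono[of "{1..n}" I] by (auto simp: Suc_le_eq card_gt_0_iff)
  qed
  have bound: "measure_pmf.prob (er n p) (B (I, J, s)) \<le> c (I, J, s)"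
    if I: "I \<in> ?P" and J: "J \<in> ?P" and s: "s \<in> {1..n * n}" for I J s
  proof (cases "Q I J s")
    case False
    then show ?thesis by (simp add: B_def c_def w_def K_def)
  next
    case True
    have S: "I \<times> J \<subseteq> grid n" "I \<times> J \<noteq> {}" using I J by (auto simp: grid_def)
    have \<mu>: "real (card (I \<times> J)) * d / n = \<mu> I J" by (simp add: \<mu>_def card_cartesian_product)
    have "exp 1 * (real (card (I \<times> J)) * d / n) \<le> real s" unfolding \<mu> using True by (simp add: Q_def)
    from er_edge_count_tail[OF p n d S this]
    have "measure_pmf.prob (er n p) (B (I, J, s)) \<le> exp (- (s * ln (s / (exp 1 * \<mu> I J))))"
      unfolding \<mu> using True by (simp add: B_def)
    also have "\<dots> \<le> exp (- (7 * r * entropy n (M I J)))" using True by (simp add: Q_def)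
    also have "\<dots> \<le> exp (- ((7 * r - 2) * (1 + ln n)) - entropy n (card I) - entropy n (card J))"
    proof -
      have M: "1 \<le> M I J" "M I J \<le> n" "card I \<le> M I J" "card J \<le> M I J"
        using cardP[OF I] cardP[OF J] by (auto simp: M_def)
      have "entropy n (card I) \<le> entropy n (M I J)" "entropy n (card J) \<le> entropy n (M I J)"
        using M cardP[OF I] cardP[OF J] by (auto intro!: entropy_mono)
      moreover have "(7 * r - 2) * (1 + ln n) \<le> (7 * r - 2) * entropy n (M I J)"
        using r M by (intro mult_left_mono entropy_ge) auto
      ultimately show ?thesis by (simp add: algebra_simps)
    qed
    also have "\<dots> = c (I, J, s)" by (simp add: c_def K_def w_def flip: exp_add)
    finally show ?thesis .
  qed
  have "measure_pmf.prob (er n p) {A. \<not> discrepancy n d r A} =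
      measure_pmf.prob (er n p) ({A. \<not> discrepancy n d r A} \<inter> set_pmf (er n p))"
    by (simp add: measure_Int_set_pmf)
  also have "\<dots> \<le> (\<Sum>x\<in>?P \<times> ?P \<times> {1..n * n}. c x)"
  proof (rule prob_UN_le)
    show "{A. \<not> discrepancy n d r A} \<inter> set_pmf (er n p) \<subseteq> (\<Union>x\<in>?P \<times> ?P \<times> {1..n * n}. B x)"
    proof
      fix A assume A: "A \<in> {A. \<not> discrepancy n d r A} \<inter> set_pmf (er n p)"
      then have "A \<in> set_pmf (er n p)" by blast
      then have A01: "A e \<in> {0, 1}" for e by (rule set_pmf_er)
      obtain I J where IJ: "I \<in> ?P" "J \<in> ?P" and q: "Q I J (sum A (I \<times> J))"
        using A unfolding discrepancy_def Q_def \<mu>_def M_def by (auto simp: not_le)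
      have fin: "finite (I \<times> J)" using IJ by (auto intro: finite_subset)
      define s where "s = card {e \<in> I \<times> J. A e = 1}"
      have "sum A (I \<times> J) = (\<Sum>e\<in>I \<times> J. if A e = 1 then 1 else 0)"
        using A01 by (intro sum.cong) auto
      also have "\<dots> = s" using fin by (simp add: s_def sum.If_cases Int_def)
      finally have s: "sum A (I \<times> J) = s" .
      have "s \<le> card (I \<times> J)" unfolding s_def using fin by (intro card_mono) auto
      also have "\<dots> \<le> n * n" using cardP[OF IJ(1)] cardP[OF IJ(2)] by (simp add: card_cartesian_product mult_mono)
      finally have "s \<le> n * n" .
      moreover have "s \<ge> 1"
      proof -
        have "0 \<le> exp 1 * \<mu> I J" using d by (simp add: \<mu>_def)
        then have "real s > 0" using q unfolding s Q_def by linarith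
        then show ?thesis by simp
      qed
      moreover have "A \<in> B (I, J, s)" using q s by (simp add: B_def)
      ultimately show "A \<in> (\<Union>x\<in>?P \<times> ?P \<times> {1..n * n}. B x)" using IJ by (intro UN_I[of "(I, J, s)"]) auto
    qed
    show "measure_pmf.prob (er n p) (B x) \<le> c x" if "x \<in> ?P \<times> ?P \<times> {1..n * n}" for x
      using that bound by (cases x) auto
  qed auto
  also have "\<dots> = (\<Sum>I\<in>?P. \<Sum>J\<in>?P. \<Sum>s\<in>{1..n * n}. K * w I * w J)"
    by (simp only: sum.cartesian_product c_def case_prod_unfold fst_conv snd_conv)
  also have "\<dots> = real (n * n) * K * ((\<Sum>I\<in>?P. w I) * (\<Sum>J\<in>?P. w J))"
    by (subst sum_product) (simp add: sum_distrib_left mult_ac)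
  also have "\<dots> \<le> real (n * n) * K * (real n * real n)"
    using sum_nonempty_subsets_entropy[of n] unfolding w_def
    by (intro mult_left_mono mult_mono) (auto simp: K_def intro: sum_nonneg)
  also have "\<dots> = exp (4 * ln n - (7 * r - 2) * (1 + ln n))"
  proof -
    have n4: "real (n * n) * (real n * real n) = exp (4 * ln n)"
      using n0 exp_of_nat_mult[of 4 "ln (real n)"] by (simp add: power4_eq_xxxx)
    have "real (n * n) * K * (real n * real n) = real (n * n) * (real n * real n) * K"
      by (simp only: mult_ac)
    also have "\<dots> = exp (4 * ln n - (7 * r - 2) * (1 + ln n))"
      unfolding n4 K_def by (simp flip: exp_add)
    finally show ?thesis .
  qed
  also have "\<dots> \<le> exp (- r * ln n + (- 1))"
  proof -
    have "6 * ln n \<le> 6 * (r * ln n)" using mult_right_mono[OF r ln0] by simp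
    then show ?thesis using r by (simp add: algebra_simps)
  qed
  also have "\<dots> = real n powr (- r) * exp (- 1)"
    using n0 by (simp add: powr_def flip: exp_add)
  also have "\<dots> \<le> real n powr (- r) * (1 / 2)"
    using exp_minus_1_le_half by (intro mult_left_mono) auto
  finally show ?thesis by simp
qed

text \<open>The constant comes from \<open>25 / 4 * 454 = 2837.5\<close>. At most four exceptional
  events occur, each of probability at most \<open>n powr (- r) / 2\<close>. For
  \<open>d = 0\<close> the quotient \<open>n / d\<close> stands for infinity, hence the guard
  \<open>d > 0\<close>.\<close>

theorem theorem2p6:
  shows "\<exists>C::real. C > 0 \<and>
    (\<forall>(n::nat) (p::matrix) (d::real) (r::real).
      n \<ge> 1 \<longrightarrow> (\<forall>e\<in>grid n. 0 \<le> p e \<and> p e \<le> 1) \<longrightarrow>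
      d = Max ((\<lambda>e. real n * p e) ` grid n) \<longrightarrow> r \<ge> 1 \<longrightarrow>
      measure_pmf.prob (er n p)
        {A. \<exists>N R K.
           N \<union> R \<union> K = grid n \<and> N \<inter> R = {} \<and> N \<inter> K = {} \<and> R \<inter> K = {} \<and>
           spectral_norm n (restr (\<lambda>e. A e - mean (er n p) e) N) \<le> C * r powr (3/2) * sqrt d \<and>
           (\<forall>i\<in>{1..n}. real (card {j\<in>{1..n}. restr A R (i, j) = 1}) \<le> 32 * r) \<and>
           (\<forall>j\<in>{1..n}. real (card {i\<in>{1..n}. restr A K (i, j) = 1}) \<le> 32 * r) \<and>
           (d > 0 \<longrightarrow>
              real (card {j\<in>{1..n}. \<exists>i. (i, j) \<in> R}) \<le> real n / d \<and>
              real (card {i\<in>{1..n}. \<exists>j. (i, j) \<in> K}) \<le> real n / d)}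
      \<ge> 1 - 3 * real n powr (- r))"
proof (intro exI[of _ 2838] conjI allI impI)
  fix n :: nat and p :: matrix and d r :: real
  assume n: "n \<ge> 1" and p01: "\<forall>e\<in>grid n. 0 \<le> p e \<and> p e \<le> 1"
    and d_def: "d = Max ((\<lambda>e. real n * p e) ` grid n)" and r: "r \<ge> 1"
  define good where "good A \<longleftrightarrow> (\<exists>N R K.
     N \<union> R \<union> K = grid n \<and> N \<inter> R = {} \<and> N \<inter> K = {} \<and> R \<inter> K = {} \<and>
     spectral_norm n (restr (\<lambda>e. A e - mean (er n p) e) N) \<le> 2838 * r powr (3/2) * sqrt d \<and>
     (\<forall>i\<in>{1..n}. real (card {j\<in>{1..n}. restr A R (i, j) = 1}) \<le> 32 * r) \<and>
     (\<forall>j\<in>{1..n}. real (card {i\<in>{1..n}. restr A K (i, j) = 1}) \<le> 32 * r) \<and>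
     (d > 0 \<longrightarrow>
        real (card {j\<in>{1..n}. \<exists>i. (i, j) \<in> R}) \<le> real n / d \<and>
        real (card {i\<in>{1..n}. \<exists>j. (i, j) \<in> K}) \<le> real n / d))" for A
  have ne: "(1, 1) \<in> grid n" using n by (auto simp: grid_def)
  have p: "0 \<le> p e \<and> p e \<le> 1 \<and> real n * p e \<le> d" if "e \<in> grid n" for e
    using p01 that unfolding d_def by (auto intro!: Max_ge)
  have n0: "real n > 0" using n by simp
  have "0 \<le> real n * p (1, 1)" using p[OF ne] by simp
  then have d0: "d \<ge> 0" using p[OF ne] by linarith
  have restr_mean: "restr (\<lambda>e. A e - mean (er n p) e) N = restr (\<lambda>e. A e - p e) N" if "N \<subseteq> grid n" for A N
    using that p01 by (auto simp: restr_def fun_eq_iff mean_er)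
  have "r powr 1 \<le> r powr (3 / 2)" using r by (intro powr_mono) auto
  then have rr: "r \<le> r powr (3 / 2)" using r by simp
  have goodI: "good A"
    if "R \<union> K = E" "R \<inter> K = {}" "E \<subseteq> grid n"
      "\<And>i. card {j. (i, j) \<in> R} \<le> 32 * r" "\<And>j. card {i. (i, j) \<in> K} \<le> 32 * r"
      "spectral_norm n (restr (\<lambda>e. A e - p e) (grid n - E)) \<le> 2838 * r * sqrt d"
      "d > 0 \<Longrightarrow> card {j\<in>{1..n}. \<exists>i. (i, j) \<in> R} \<le> n / d"
      "d > 0 \<Longrightarrow> card {i\<in>{1..n}. \<exists>j. (i, j) \<in> K} \<le> n / d"
    for A R K E
    unfolding good_def
  proof (rule exI[of _ "grid n - E"], rule exI[of _ R], rule exI[of _ K], intro conjI ballI impI)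
    have finE: "finite E" using that(3) finite_subset finite_grid by blast
    have finR: "finite {j. (i, j) \<in> R}" for i
      by (rule finite_subset[of _ "snd ` E"]) (use that(1) finE in force)+
    have finK: "finite {i. (i, j) \<in> K}" for j
      by (rule finite_subset[of _ "fst ` E"]) (use that(1) finE in force)+
    show "real (card {j\<in>{1..n}. restr A R (i, j) = 1}) \<le> 32 * r" for i
    proof -
      have "card {j\<in>{1..n}. restr A R (i, j) = 1} \<le> card {j. (i, j) \<in> R}"
        using finR by (intro card_mono) (auto simp: restr_def split: if_splits)
      then show ?thesis using that(4)[of i] by linarith
    qed
    show "real (card {i\<in>{1..n}. restr A K (i, j) = 1}) \<le> 32 * r" for j
    proof -
      have "card {i\<in>{1..n}. restr A K (i, j) = 1} \<le> card {i. (i, j) \<in> K}"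
        using finK by (intro card_mono) (auto simp: restr_def split: if_splits)
      then show ?thesis using that(5)[of j] by linarith
    qed
    have "2838 * r * sqrt d \<le> 2838 * r powr (3 / 2) * sqrt d"
      using rr d0 by (intro mult_right_mono) auto
    then show "spectral_norm n (restr (\<lambda>e. A e - mean (er n p) e) (grid n - E)) \<le> 2838 * r powr (3 / 2) * sqrt d"
      using that(6) by (simp add: restr_mean)
  qed (use that in auto)
  \<comment> \<open>For \<open>0 < d \<le> 1\<close> only the discrepancy property is required; for
    \<open>d = 0\<close> nothing can fail on the support.\<close>
  define bad where "bad = (if d = 0 then {} else {A. \<not> discrepancy n d r A} \<union>
     (if d \<le> 1 then {} else {A. \<not> light_concentration n d r p A} \<union>
       ({A. \<not> 2 * real (card {i\<in>{1..n}. 8 * r * d < sum A ({i} \<times> {1..n})}) * d\<^sup>2 \<le> n} \<union>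
        {A. \<not> 2 * real (card {j\<in>{1..n}. 8 * r * d < sum A ({1..n} \<times> {j})}) * d\<^sup>2 \<le> n})))"
  let ?P = "measure_pmf.prob (er n p)"
  define \<epsilon> where "\<epsilon> = real n powr (- r) / 2"
  have \<epsilon>: "\<epsilon> \<ge> 0" by (simp add: \<epsilon>_def)
  have union: "?P (S \<union> (T \<union> (U \<union> V))) \<le> ?P S + ?P T + ?P U + ?P V" for S T U V
    using measure_Un_le[of S "er n p" "T \<union> (U \<union> V)"] measure_Un_le[of T "er n p" "U \<union> V"]
      measure_Un_le[of U "er n p" V] by simp
  have "?P bad \<le> 4 * \<epsilon>"
  proof -
    have disc: "?P {A. \<not> discrepancy n d r A} \<le> \<epsilon>" if "d > 0"
      unfolding \<epsilon>_def using n that r p by (rule prob_not_discrepancy)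
    have light: "?P {A. \<not> light_concentration n d r p A} \<le> \<epsilon>" if "d > 0"
      unfolding \<epsilon>_def using n that r p by (rule prob_not_light_concentration)
    have rows: "?P {A. \<not> 2 * real (card {i\<in>{1..n}. 8 * r * d < sum A ({i} \<times> {1..n})}) * d\<^sup>2 \<le> n} \<le> \<epsilon>" if "d \<ge> 1"
      unfolding \<epsilon>_def using n that r p
      by (rule prob_many_heavy_lines) (auto simp: grid_def disjoint_family_on_def)
    have cols: "?P {A. \<not> 2 * real (card {j\<in>{1..n}. 8 * r * d < sum A ({1..n} \<times> {j})}) * d\<^sup>2 \<le> n} \<le> \<epsilon>" if "d \<ge> 1"
      unfolding \<epsilon>_def using n that r p
      by (rule prob_many_heavy_lines) (auto simp: grid_def disjoint_family_on_def card_cartesian_product)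
    show ?thesis
    proof (cases "d \<le> 1")
      case True
      then show ?thesis using disc d0 \<epsilon> by (auto simp: bad_def)
    next
      case False
      then have d: "d > 0" "d \<ge> 1" "d \<noteq> 0" by auto
      show ?thesis
        unfolding bad_def if_not_P[OF d(3)] if_not_P[OF False]
        using disc[OF d(1)] light[OF d(1)] rows[OF d(2)] cols[OF d(2)]
        by (intro order.trans[OF union]) linarith
    qed
  qed
  moreover have good: "good A" if A: "A \<in> set_pmf (er n p)" and nb: "A \<notin> bad" for A
  proof -
    have A01: "A e \<in> {0, 1}" for e using A by (rule set_pmf_er)
    consider (zero) "d = 0" | (sparse) "0 < d" "d \<le> 1" | (dense) "d > 1" using d0 by linarith
    then show ?thesis
    proof cases
      case zero
      \<comment> \<open>All probabilities vanish, so on the support \<open>A\<close> equals its mean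
        and \<open>N\<close> can be the whole grid.\<close>
      have "A e = p e" if e: "e \<in> grid n" for e
      proof -
        have "real n * p e = 0" using p[OF e] zero n0 by (intro antisym) auto
        then have pe: "p e = 0" using n0 by simp
        have "A e \<in> set_pmf (map_pmf (\<lambda>f. f e) (er n p))" using A by simp
        also have "map_pmf (\<lambda>f. f e) (er n p) = map_pmf of_bool (bernoulli_pmf (p e))"
          unfolding er_def using e by (subst Pi_pmf_component) auto
        finally obtain b where b: "b \<in> set_pmf (bernoulli_pmf 0)" "A e = of_bool b"
          by (auto simp: pe)
        have "pmf (bernoulli_pmf 0) True = 0" by simp
        then have "\<not> b" using b(1) by (auto simp: set_pmf_eq)
        then show ?thesis using b(2) by (simp add: pe)
      qed
      then have "restr (\<lambda>e. A e - p e) (grid n - {}) = (\<lambda>_. 0)" by (auto simp: restr_def fun_eq_iff)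
      then have "spectral_norm n (restr (\<lambda>e. A e - p e) (grid n - {})) \<le> 25 / 4 * 0"
        using n by (intro spectral_norm_le_dyadic_net) auto
      then show ?thesis using zero r by (intro goodI[of "{}" "{}" "{}"]) auto
    next
      case sparse
      define E where "E = {e \<in> grid n. A e = 1}"
      have disc: "discrepancy n d r A" using nb sparse by (auto simp: bad_def)
      have E: "E \<subseteq> grid n" "E \<subseteq> {e. A e = 1}" by (auto simp: E_def)
      have "fst ` E \<subseteq> {1..n}" by (auto simp: E_def grid_def)
      then have "card (fst ` E) \<le> n" using card_mono[of "{1..n}" "fst ` E"] by simp
      then have "card (fst ` E) * d\<^sup>2 \<le> real n * 1"
        using sparse by (intro mult_mono) (auto simp: power_le_one)
      then have "card (fst ` E) * d\<^sup>2 \<le> n" by simp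
      from peel_core[OF n sparse(1) r disc A01 E this]
      obtain R K where RK: "R \<union> K = E" "R \<inter> K = {}"
        "\<And>i. card {j. (i, j) \<in> R} \<le> 32 * r" "\<And>j. card {i. (i, j) \<in> K} \<le> 32 * r" by metis
      \<comment> \<open>For \<open>d \<le> 1\<close> the bound \<open>n / d\<close> is at least
        \<open>n\<close>, so the numbers of rows and columns met are under control whatever the
        peeling does.\<close>
      have card_le: "real (card {j\<in>{1..n}. Z j}) \<le> n / d" for Z
      proof -
        have "card {j\<in>{1..n}. Z j} \<le> card {1..n}" by (intro card_mono) auto
        then have "real (card {j\<in>{1..n}. Z j}) * d \<le> real n * 1" using sparse by (intro mult_mono) auto
        then show ?thesis using sparse by (simp add: field_simps)
      qed
      have "spectral_norm n (restr (\<lambda>e. A e - p e) (grid n - E)) \<le> 25 / 4 * (2 * sqrt d)"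
        unfolding E_def using n sparse A01 p by (rule spectral_norm_sparse)
      also have "\<dots> \<le> 2838 * r * sqrt d"
        using r sparse mult_right_mono[of 1 r "sqrt d"] by simp
      finally show ?thesis by (intro goodI[OF RK(1,2) E(1) RK(3,4)] card_le)
    next
      case dense
      then have d1: "d \<ge> 1" by simp
      define I where "I = {i\<in>{1..n}. 8 * r * d < (\<Sum>j=1..n. A (i, j))}"
      define J where "J = {j\<in>{1..n}. 8 * r * d < (\<Sum>i=1..n. A (i, j))}"
      define E where "E = {(i, j) \<in> grid n. A (i, j) = 1 \<and> (i \<in> I \<or> j \<in> J)}"
      have rowsum: "sum A ({i} \<times> {1..n}) = (\<Sum>j=1..n. A (i, j))" for i
        using sum.cartesian_product[of "\<lambda>i j. A (i, j)" "{1..n}" "{i}"] by simp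
      have colsum: "sum A ({1..n} \<times> {j}) = (\<Sum>i=1..n. A (i, j))" for j
        using sum.cartesian_product[of "\<lambda>i j. A (i, j)" "{j}" "{1..n}"] by simp
      have disc: "discrepancy n d r A" and light: "light_concentration n d r p A"
        and cI: "2 * real (card I) * d\<^sup>2 \<le> n" and cJ: "2 * real (card J) * d\<^sup>2 \<le> n"
        using nb dense unfolding bad_def I_def J_def rowsum[symmetric] colsum[symmetric] by auto
      have IJ: "I \<subseteq> {1..n}" "J \<subseteq> {1..n}" by (auto simp: I_def J_def)
      obtain R K where RK: "R \<union> K = E" "R \<inter> K = {}"
        "\<And>i. card {j. (i, j) \<in> R} \<le> 32 * r" "\<And>j. card {i. (i, j) \<in> K} \<le> 32 * r"
        "card {j. \<exists>i. (i, j) \<in> R} \<le> n / d" "card {i. \<exists>j. (i, j) \<in> K} \<le> n / d"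
      proof (rule edge_split[OF n d1 r disc A01 IJ(1) cI IJ(2) cJ])
        fix R K
        assume "R \<union> K = {(i, j) \<in> grid n. A (i, j) = 1 \<and> (i \<in> I \<or> j \<in> J)}" "R \<inter> K = {}"
          "\<And>i. card {j. (i, j) \<in> R} \<le> 32 * r" "\<And>j. card {i. (i, j) \<in> K} \<le> 32 * r"
          "card {j. \<exists>i. (i, j) \<in> R} \<le> n / d" "card {i. \<exists>j. (i, j) \<in> K} \<le> n / d"
        then show thesis unfolding E_def[symmetric] by (rule that)
      qed
      have E: "E \<subseteq> grid n" by (auto simp: E_def)
      have "(i, j) \<in> R \<Longrightarrow> i \<in> {1..n} \<and> j \<in> {1..n}" "(i, j) \<in> K \<Longrightarrow> i \<in> {1..n} \<and> j \<in> {1..n}" for i j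
        using RK(1) E by (auto simp: grid_def)
      then have "{j\<in>{1..n}. \<exists>i. (i, j) \<in> R} = {j. \<exists>i. (i, j) \<in> R}" "{i\<in>{1..n}. \<exists>j. (i, j) \<in> K} = {i. \<exists>j. (i, j) \<in> K}"
        by blast+
      note cards = RK(5,6)[folded this]
      have "spectral_norm n (restr (\<lambda>e. A e - p e) (grid n - E)) \<le> 25 / 4 * (454 * r * sqrt d)"
        unfolding E_def by (rule spectral_norm_dense[OF n d1 r disc A01 p light I_def cI J_def cJ])
      also have "\<dots> \<le> 2838 * r * sqrt d" using r d0 by simp
      finally show ?thesis by (intro goodI[OF RK(1,2) E RK(3,4)] cards)
    qed
  qed
  moreover have "1 - ?P {A. good A} \<le> ?P bad"
  proof -
    have "1 - ?P {A. good A} = ?P (- {A. good A})"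
      using measure_pmf.prob_compl[of "{A. good A}" "er n p"] by (simp add: Compl_eq_Diff_UNIV)
    also have "\<dots> = ?P (- {A. good A} \<inter> set_pmf (er n p))" by (simp add: measure_Int_set_pmf)
    also have "\<dots> \<le> ?P bad" using good by (intro measure_pmf.finite_measure_mono) auto
    finally show ?thesis .
  qed
  ultimately have "1 - 4 * \<epsilon> \<le> ?P {A. good A}" by linarith
  moreover have "4 * \<epsilon> \<le> 3 * real n powr (- r)" by (simp add: \<epsilon>_def)
  ultimately have "1 - 3 * real n powr (- r) \<le> ?P {A. good A}" by linarith
  then show "1 - 3 * real n powr (- r) \<le> ?P {A. \<exists>N R K.
     N \<union> R \<union> K = grid n \<and> N \<inter> R = {} \<and> N \<inter> K = {} \<and> R \<inter> K = {} \<and>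
     spectral_norm n (restr (\<lambda>e. A e - mean (er n p) e) N) \<le> 2838 * r powr (3/2) * sqrt d \<and>
     (\<forall>i\<in>{1..n}. real (card {j\<in>{1..n}. restr A R (i, j) = 1}) \<le> 32 * r) \<and>
     (\<forall>j\<in>{1..n}. real (card {i\<in>{1..n}. restr A K (i, j) = 1}) \<le> 32 * r) \<and>
     (d > 0 \<longrightarrow>
        real (card {j\<in>{1..n}. \<exists>i. (i, j) \<in> R}) \<le> real n / d \<and>
        real (card {i\<in>{1..n}. \<exists>j. (i, j) \<in> K}) \<le> real n / d)}"
    unfolding good_def .
qed simp

end
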